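(* Let $n\ge 3$, let $\Omega=\mathbb{R}^n\setminus\overline{B(0,1)}$, and let $\varphi(x)=n\log|x|$ on $\Omega$. For each integer $m\ge 1$ define on $\Omega$ $$u_m(x)=|x|^{-1/m},\qquad f_m=Du_m=-\frac1m|x|^{-1/m-2}x .$$ Then $Du_m=f_m$ in $\Omega$; $u_m$ is the solution of minimal $L^2_\varphi$-norm, i.e. the element of minimal norm $\|\cdot\|_\varphi$ among all $u\in L^2_\varphi(\Omega,\mathbb{R}_n)$ with $Du=f_m$ in $\Omega$; and $$\lim_{m\to+\infty}\frac{\|u_m\|_\varphi^2}{\displaystyle\int_\Omega\frac{|f_m|^2}{\Delta\varphi}e^{-\varphi}\,dV}=+\infty .$$ In particular, there is no finite constant $C$ (depending only on $\Omega$ and $\varphi$) such that every $f\in L^2_\varphi(\Omega,\mathbb{R}_n)$ with $\int_\Omega\frac{|f|^2}{\Delta\varphi}e^{-\varphi}\,dV<\infty$ admits a solution $u\in L^2_\varphi(\Omega,\mathbb{R}_n)$ of $Du=f$ in $\Omega$ satisfying $$\|u\|_\varphi^2\le C\int_\Omega\frac{|f|^2}{\Delta\varphi}e^{-\varphi}\,dV .$$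
   Context: $\mathbb{R}_n$ is the real Clifford algebra: the associative unital $\mathbb{R}$-algebra generated by $e_1,\dots,e_n$ with $e_j^2=-1$ and $e_je_k+e_ke_j=0$ for $j\ne k$. It has real dimension $2^n$, with basis $e_A=e_{j_1}\cdots e_{j_\ell}$ for $A=\{j_1<\dots<j_\ell\}\subset\{1,\dots,n\}$, $e_\emptyset=1$. For $f=\sum_A f_Ae_A$ put $|f|^2=\sum_A f_A^2$, and $\langle f,g\rangle=\sum_A f_Ag_A$. A point $x=(x_1,\dots,x_n)\in\mathbb{R}^n$ is identified with the vector $x=\sum_j x_je_j\in\mathbb{R}_n$, and $|x|$ is its Euclidean norm; real numbers are identified with multiples of $1\in\mathbb{R}_n$. The Dirac operator is $Du=\sum_{j=1}^n e_j\,\partial_ju$. For a real continuous weight $\varphi$ on $\Omega$, $L^2_\varphi(\Omega,\mathbb{R}_n)$ is the space of measurable $u:\Omega\to\mathbb{R}_n$ with $\|u\|_\varphi^2=\int_\Omega|u|^2e^{-\varphi}\,dV<\infty$, where $dV$ is Lebesgue measure. For $u\in L^2_\varphi$, the equation $Du=f$ is understood in the sense of distributions: $\int_\Omega\langle f,v\rangle\,dV=\int_\Omega\langle u,Dv\rangle\,dV$ for all $v\in C_c^\infty(\Omega,\mathbb{R}_n)$. $B(0,1)$ is the open Euclidean unit ball and $\Delta=\sum_j\partial_j^2$. *)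

theory Defs
  imports "HOL-Analysis.Analysis"
begin

section \<open>The real Clifford algebra\<close>

text \<open>
  An element \<open>f = (\<Sum>A. f\<^sub>A e\<^sub>A)\<close> of the Clifford algebra on generators \<open>e\<^sub>j\<close>, \<open>j :: 'n\<close>, is the vector
  of its coordinates \<open>f $ A\<close>, so the library norm and inner product of \<open>real ^ ('n set)\<close> are
  \<open>|f|\<close> and \<open>\<langle>f, g\<rangle>\<close>. The linear order on \<open>'n\<close> is the one used to order the factors of \<open>e\<^sub>A\<close>.
  Multiplication is \<open>clif_mult\<close> and not \<open>(*)\<close>, which is the componentwise product on this type.
\<close>

type_synonym 'n clifford = "real ^ ('n set)"

definition clif_basis :: "'n::{finite,linorder} set \<Rightarrow> 'n clifford" where
  "clif_basis A = axis A 1"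

text \<open>
  Sorting the word \<open>e\<^sub>A e\<^sub>B\<close> costs a factor \<open>-1\<close> for each pair \<open>a \<in> A\<close>, \<open>b \<in> B\<close> with \<open>b < a\<close>
  (anticommutation) and for each \<open>a = b\<close> (as \<open>e\<^sub>a\<^sup>2 = -1\<close>); the factors that remain are those with
  index in the symmetric difference of \<open>A\<close> and \<open>B\<close>.
\<close>

definition clif_sign :: "'n::{finite,linorder} set \<Rightarrow> 'n set \<Rightarrow> real" where
  "clif_sign A B = (\<Prod>a\<in>A. \<Prod>b\<in>B. if b \<le> a then -1 else 1)"

definition clif_mult :: "'n::{finite,linorder} clifford \<Rightarrow> 'n clifford \<Rightarrow> 'n clifford"
    (infixl "\<odot>" 70) where
  "f \<odot> g = (\<Sum>A\<in>UNIV. \<Sum>B\<in>UNIV. (f $ A * g $ B * clif_sign A B) *\<^sub>R clif_basis (sym_diff A B))"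

definition clif_of_real :: "real \<Rightarrow> 'n::{finite,linorder} clifford" where
  "clif_of_real r = r *\<^sub>R clif_basis {}"

definition clif_gen :: "'n::{finite,linorder} \<Rightarrow> 'n clifford" where
  "clif_gen j = clif_basis {j}"

definition clif_vec :: "real ^ 'n::{finite,linorder} \<Rightarrow> 'n::{finite,linorder} clifford" where
  "clif_vec x = (\<Sum>j\<in>UNIV. x $ j *\<^sub>R clif_gen j)"

text \<open>
  The lemmas below show that \<open>clif_mult\<close> is an associative unital bilinear product satisfying the
  defining relations, and that \<open>clif_basis A\<close> is the increasing product of generators.
\<close>

lemma clif_expand: "f = (\<Sum>A\<in>UNIV. f $ A *\<^sub>R clif_basis A)"
  using basis_expansion[of f] by (simp add: clif_basis_def scalar_mult_eq_scaleR)

lemma bilinear_clif_mult: "bilinear (\<odot>)"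
  unfolding bilinear_def clif_mult_def
  by (auto intro!: linearI simp: sum.distrib scaleR_sum_right algebra_simps)

lemma clif_basis_mult: "clif_basis A \<odot> clif_basis B = clif_sign A B *\<^sub>R clif_basis (sym_diff A B)"
proof -
  have "clif_basis A \<odot> clif_basis B =
    (\<Sum>A'\<in>UNIV. \<Sum>B'\<in>UNIV. if A' = A then (if B' = B then
        clif_sign A B *\<^sub>R clif_basis (sym_diff A B) else 0) else 0)"
    unfolding clif_mult_def
    by (intro sum.cong refl) (auto simp: clif_basis_def axis_def)
  also have "\<dots> = (\<Sum>A'\<in>UNIV. if A' = A then (\<Sum>B'\<in>UNIV. if B' = B then
        clif_sign A B *\<^sub>R clif_basis (sym_diff A B) else 0) else 0)"
    by (intro sum.cong refl) auto
  finally show ?thesis by simp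
qed

lemma prod_sym_diff:
  fixes g :: "'a::finite \<Rightarrow> real"
  assumes "\<And>a. g a * g a = 1"
  shows "prod g (sym_diff A B) = prod g A * prod g B"
proof -
  have "prod g A = prod g (A - B) * prod g (A \<inter> B)"
    by (subst prod.union_disjoint [symmetric]) (auto intro: prod.cong)
  moreover have "prod g B = prod g (B - A) * prod g (A \<inter> B)"
    by (subst prod.union_disjoint [symmetric]) (auto intro: prod.cong)
  moreover have "prod g (A \<inter> B) * prod g (A \<inter> B) = 1"
    by (simp add: prod.distrib [symmetric] assms)
  moreover have "prod g (sym_diff A B) = prod g (A - B) * prod g (B - A)"
    by (rule prod.union_disjoint) auto
  ultimately show ?thesis by algebra
qed

lemma clif_sign_sym_diff_left: "clif_sign (sym_diff A B) C = clif_sign A C * clif_sign B C"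
  unfolding clif_sign_def
  by (rule prod_sym_diff) (auto simp: prod.distrib [symmetric] intro!: prod.neutral)

lemma clif_sign_sym_diff_right: "clif_sign A (sym_diff B C) = clif_sign A B * clif_sign A C"
  unfolding clif_sign_def prod.distrib [symmetric]
  by (intro prod.cong refl prod_sym_diff) auto

lemmas clif_mult_linear =
  bilinear_lmul [OF bilinear_clif_mult] bilinear_rmul [OF bilinear_clif_mult]

lemma clif_mult_sum_left: "(\<Sum>i\<in>I. f i) \<odot> g = (\<Sum>i\<in>I. f i \<odot> g)"
  using bilinear_clif_mult by (auto simp: bilinear_def intro: linear_sum)

lemma clif_mult_sum_right: "g \<odot> (\<Sum>i\<in>I. f i) = (\<Sum>i\<in>I. g \<odot> f i)"
  using bilinear_clif_mult by (auto simp: bilinear_def intro: linear_sum)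

lemma clif_mult_assoc: "f \<odot> g \<odot> h = f \<odot> (g \<odot> h)"
proof -
  have basis: "clif_basis A \<odot> clif_basis B \<odot> clif_basis C = clif_basis A \<odot> (clif_basis B \<odot> clif_basis C)"
    for A B C :: "'a set"
  proof -
    have "sym_diff (sym_diff A B) C = sym_diff A (sym_diff B C)" by auto
    then show ?thesis
      by (simp only: clif_basis_mult clif_mult_linear clif_sign_sym_diff_left
          clif_sign_sym_diff_right scaleR_scaleR mult_ac)
  qed
  show ?thesis
    by (subst (1 2) clif_expand [of f], subst (1 2) clif_expand [of g], subst (1 2) clif_expand [of h])
      (simp add: clif_mult_sum_left clif_mult_sum_right clif_mult_linear basis)
qed

lemma clif_of_real_mult: "clif_of_real r \<odot> f = r *\<^sub>R f" "f \<odot> clif_of_real r = r *\<^sub>R f"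
proof -
  have "clif_of_real r \<odot> (\<Sum>A\<in>UNIV. f $ A *\<^sub>R clif_basis A) = r *\<^sub>R (\<Sum>A\<in>UNIV. f $ A *\<^sub>R clif_basis A)"
    by (simp add: clif_of_real_def clif_mult_sum_right clif_mult_linear clif_basis_mult
        clif_sign_def scaleR_sum_right mult.commute)
  then show "clif_of_real r \<odot> f = r *\<^sub>R f" by (simp flip: clif_expand)
  have "(\<Sum>A\<in>UNIV. f $ A *\<^sub>R clif_basis A) \<odot> clif_of_real r = r *\<^sub>R (\<Sum>A\<in>UNIV. f $ A *\<^sub>R clif_basis A)"
    by (simp add: clif_of_real_def clif_mult_sum_left clif_mult_linear clif_basis_mult
        clif_sign_def scaleR_sum_right mult.commute)
  then show "f \<odot> clif_of_real r = r *\<^sub>R f" by (simp flip: clif_expand)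
qed

lemma clif_gen_square: "clif_gen j \<odot> clif_gen j = clif_of_real (-1)"
  by (simp add: clif_gen_def clif_basis_mult clif_sign_def clif_of_real_def)

lemma clif_gen_anticommute:
  assumes "j \<noteq> k"
  shows "clif_gen j \<odot> clif_gen k + clif_gen k \<odot> clif_gen j = 0"
proof -
  have "sym_diff {j} {k} = {j, k}" "sym_diff {k} {j} = {j, k}" using assms by auto
  then show ?thesis using assms
    by (cases "j \<le> k") (auto simp: clif_gen_def clif_basis_mult clif_sign_def)
qed

lemma clif_basis_eq_prod_gen:
  "clif_basis A = foldr (\<odot>) (map clif_gen (sorted_list_of_set A)) (clif_of_real 1)"
proof -
  have "sorted xs \<Longrightarrow> distinct xs \<Longrightarrow>
      clif_basis (set xs) = foldr (\<odot>) (map clif_gen xs) (clif_of_real 1)" for xs :: "'a list"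
  proof (induction xs)
    case Nil
    then show ?case by (simp add: clif_of_real_def)
  next
    case (Cons a xs)
    have "sym_diff {a} (set xs) = insert a (set xs)" using Cons.prems by auto
    moreover have "clif_sign {a} (set xs) = 1"
      using Cons.prems by (auto simp: clif_sign_def intro!: prod.neutral)
    ultimately have "clif_gen a \<odot> clif_basis (set xs) = clif_basis (insert a (set xs))"
      by (simp add: clif_gen_def clif_basis_mult)
    then show ?case using Cons by simp
  qed
  from this [of "sorted_list_of_set A"] show ?thesis by simp
qed


section \<open>Differential operators\<close>

definition partial_deriv :: "'n::finite \<Rightarrow> (real ^ 'n \<Rightarrow> 'b::real_normed_vector) \<Rightarrow> real ^ 'n \<Rightarrow> 'b" where
  "partial_deriv j u x = vector_derivative (\<lambda>t. u (x + t *\<^sub>R axis j 1)) (at 0)"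

definition laplacian :: "(real ^ 'n::finite \<Rightarrow> real) \<Rightarrow> real ^ 'n \<Rightarrow> real" where
  "laplacian u x = (\<Sum>j\<in>UNIV. partial_deriv j (partial_deriv j u) x)"

definition dirac :: "(real ^ 'n::{finite,linorder} \<Rightarrow> 'n clifford) \<Rightarrow> real ^ 'n::{finite,linorder} \<Rightarrow> 'n clifford" where
  "dirac u x = (\<Sum>j\<in>UNIV. clif_gen j \<odot> partial_deriv j u x)"

primrec C_k :: "nat \<Rightarrow> (real ^ 'n::finite \<Rightarrow> 'b::real_normed_vector) \<Rightarrow> bool" where
  "C_k 0 u \<longleftrightarrow> continuous_on UNIV u"
| "C_k (Suc k) u \<longleftrightarrow> (\<forall>x. u differentiable (at x)) \<and> (\<forall>j. C_k k (partial_deriv j u))"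

text \<open>\<open>C\<^sub>c\<^sup>\<infinity>(\<Omega>)\<close>, its elements being extended by zero to the whole space.\<close>

definition test_functions :: "(real ^ 'n::finite) set \<Rightarrow> (real ^ 'n \<Rightarrow> 'b::real_normed_vector) set" where
  "test_functions \<Omega> =
    {v. (\<forall>k. C_k k v) \<and> compact (closure {x. v x \<noteq> 0}) \<and> closure {x. v x \<noteq> 0} \<subseteq> \<Omega>}"


section \<open>Weighted spaces and the equation \<open>Du = f\<close>\<close>

definition L2_weighted ::
    "('a::euclidean_space \<Rightarrow> real) \<Rightarrow> 'a set \<Rightarrow> ('a \<Rightarrow> 'b::euclidean_space) set" where
  "L2_weighted \<phi> \<Omega> = {u \<in> borel_measurable (lebesgue_on \<Omega>).
    integrable (lebesgue_on \<Omega>) (\<lambda>x. (norm (u x))\<^sup>2 * exp (- \<phi> x))}"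

definition norm_weighted ::
    "('a::euclidean_space \<Rightarrow> real) \<Rightarrow> 'a set \<Rightarrow> ('a \<Rightarrow> 'b::euclidean_space) \<Rightarrow> real" where
  "norm_weighted \<phi> \<Omega> u = sqrt (LINT x|lebesgue_on \<Omega>. (norm (u x))\<^sup>2 * exp (- \<phi> x))"

text \<open>
  The Bochner integrals below are meaningful for locally integrable \<open>f\<close> and \<open>u\<close>, in particular for
  members of \<open>L2_weighted \<phi> \<Omega>\<close> with \<open>\<phi>\<close> continuous on \<open>\<Omega>\<close>.
\<close>

definition weak_dirac_solution ::
    "(real ^ 'n::{finite,linorder}) set \<Rightarrow> (real ^ 'n::{finite,linorder} \<Rightarrow> 'n clifford) \<Rightarrow> (real ^ 'n::{finite,linorder} \<Rightarrow> 'n clifford) \<Rightarrow> bool" where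
  "weak_dirac_solution \<Omega> f u \<longleftrightarrow> (\<forall>v\<in>test_functions \<Omega>.
    (LINT x|lebesgue_on \<Omega>. f x \<bullet> v x) = (LINT x|lebesgue_on \<Omega>. u x \<bullet> dirac v x))"

text \<open>Uniqueness of the minimal element is up to equality almost everywhere on \<open>\<Omega>\<close>.\<close>

definition minimal_dirac_solution ::
    "(real ^ 'n::{finite,linorder} \<Rightarrow> real) \<Rightarrow> (real ^ 'n::{finite,linorder}) set \<Rightarrow> (real ^ 'n::{finite,linorder} \<Rightarrow> 'n clifford) \<Rightarrow>
      (real ^ 'n::{finite,linorder} \<Rightarrow> 'n clifford) \<Rightarrow> bool" where
  "minimal_dirac_solution \<phi> \<Omega> f u \<longleftrightarrow>
    u \<in> L2_weighted \<phi> \<Omega> \<and> weak_dirac_solution \<Omega> f u \<and>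
    (\<forall>w\<in>L2_weighted \<phi> \<Omega>. weak_dirac_solution \<Omega> f w \<longrightarrow>
      norm_weighted \<phi> \<Omega> u \<le> norm_weighted \<phi> \<Omega> w \<and>
      (norm_weighted \<phi> \<Omega> w = norm_weighted \<phi> \<Omega> u \<longrightarrow> (AE x in lebesgue_on \<Omega>. w x = u x)))"

end

theory Submission
  imports Defs "HOL-Real_Asymp.Real_Asymp"
begin

text \<open>
  Write \<open>s = ln |x|\<close>, so that \<open>e\<^sup>-\<^sup>\<phi> = |x|\<^sup>-\<^sup>n\<close> and \<open>\<Delta>\<phi> = n (n - 2) / |x|\<^sup>2\<close>.

  The ratio in the theorem is explicit: \<open>|f\<^sub>m|\<^sup>2 / \<Delta>\<phi> = |u\<^sub>m|\<^sup>2 / (m\<^sup>2 n (n - 2))\<close> holds pointwise on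
  \<open>\<Omega>\<close>, hence the quotient equals \<open>m\<^sup>2 n (n - 2)\<close> and tends to infinity. Once \<open>u\<^sub>m\<close> is known to be
  the minimal solution, a constant \<open>C\<close> as in the last claim would have to dominate all these quotients.

  Minimality of \<open>u\<^sub>m\<close> means that \<open>u\<^sub>m\<close> is orthogonal in \<open>L\<^sup>2\<^sub>\<phi>\<close> to the weak solutions of \<open>D h = 0\<close>, i.e. that
  \<open>e\<^sup>-\<^sup>\<phi> u\<^sub>m = |x|\<^sup>-\<^sup>n e\<^sup>-\<^sup>s\<^sup>/\<^sup>m\<close> is a limit of functions \<open>D v\<close> with \<open>v\<close> a test function. For a radial
  multiple of the vector field \<open>x\<close> one finds \<open>D (|x|\<^sup>-\<^sup>n P(s) x) = - |x|\<^sup>-\<^sup>n P'(s)\<close>, so the exact primitive is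
  \<open>P(s) = m (1 - e\<^sup>-\<^sup>s\<^sup>/\<^sup>m)\<close>. It vanishes on the unit sphere but tends to the nonzero constant \<open>m\<close> at
  infinity, and has to be cut off at both ends. A cutoff in the variable \<open>s\<close> at scale \<open>k\<close> costs only
  \<open>P\<^sub>k' = O(1 / (1 + s))\<close> uniformly in \<open>k\<close> (\<open>profile_deriv_bound\<close>), while
  \<open>|x|\<^sup>-\<^sup>n (1 + s)\<^sup>-\<^sup>2\<close> is integrable over \<open>\<Omega>\<close> (\<open>log_weight_integrable\<close>): logarithmically
  slow cutoffs are just cheap enough. Dominated convergence then gives
  \<open>\<integral> \<langle>w, D v\<^sub>k\<rangle> \<rightarrow> - \<integral> \<langle>w, u\<^sub>m\<rangle> e\<^sup>-\<^sup>\<phi>\<close> for every \<open>w \<in> L\<^sup>2\<^sub>\<phi>\<close> (\<open>test_field_integral_tendsto\<close>).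
  If \<open>w\<close> solves the same equation as \<open>u\<^sub>m\<close>, the left-hand sides for \<open>w\<close> and \<open>u\<^sub>m\<close> agree for each \<open>k\<close>, so
  \<open>w - u\<^sub>m\<close> is orthogonal to \<open>u\<^sub>m\<close>, and Pythagoras (\<open>norm_weighted_minimal_if_orthogonal\<close>) gives
  minimality and uniqueness.

  Two analytic ingredients are built by hand. That a classical solution is a weak one
  (\<open>classical_imp_weak_dirac_solution\<close>) reduces to \<open>\<integral> \<partial>\<^sub>j g = 0\<close> for compactly supported \<open>C\<^sup>1\<close> functions, a
  consequence of translation invariance. Smoothness of the test fields comes from spans of functions
  that are closed under differentiation (\<open>bump_span\<close>, \<open>radial_bump\<close>).
\<close>

section \<open>Clifford multiplication and the inner product\<close>

lemma clif_basis_inner: "clif_basis A \<bullet> clif_basis B = (if A = B then 1 else 0)"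
  by (simp add: clif_basis_def inner_axis_axis)

text \<open>
  Each generator is skew-adjoint. Together with the sign from integration by parts this makes the
  Dirac operator formally self-adjoint, which is why the weak equation carries no sign. On basis
  elements both sides vanish unless \<open>B = sym_diff {j} A\<close>, and then the signs differ by that of \<open>e\<^sub>j\<^sup>2 = -1\<close>.
\<close>
lemma clif_inner_gen: "(clif_gen j \<odot> f) \<bullet> g = - (f \<bullet> (clif_gen j \<odot> g))"
proof -
  have basis: "(clif_gen j \<odot> clif_basis A) \<bullet> clif_basis B =
      - (clif_basis A \<bullet> (clif_gen j \<odot> clif_basis B))" for A B :: "'a set"
  proof (cases "B = sym_diff {j} A")
    case True
    have "sym_diff {j} B = A" using True by auto
    moreover have "clif_sign {j} B = - clif_sign {j} A"
      unfolding True clif_sign_sym_diff_right by (simp add: clif_sign_def)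
    ultimately show ?thesis
      using True by (simp add: clif_gen_def clif_basis_mult clif_basis_inner)
  next
    case False
    then have "A \<noteq> sym_diff {j} B" by auto
    then show ?thesis
      using False by (simp add: clif_gen_def clif_basis_mult clif_basis_inner)
  qed
  show ?thesis
    by (subst (1 2) clif_expand [of f], subst (1 2) clif_expand [of g])
      (simp add: clif_mult_sum_right clif_mult_linear inner_sum_left inner_sum_right basis
        sum_negf)
qed

lemma clif_gen_inner: "clif_gen i \<bullet> clif_gen j = (if i = j then 1 else 0)"
  by (simp add: clif_gen_def clif_basis_inner)

lemma norm_clif_vec: "norm (clif_vec x) = norm x"
proof -
  have "clif_vec x \<bullet> clif_vec x = x \<bullet> x"
    unfolding inner_vec_def [of x x]
    by (simp add: clif_vec_def inner_sum_left inner_sum_right clif_gen_inner if_distrib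
        cong: if_cong)
  then show ?thesis by (simp add: norm_eq_sqrt_inner)
qed

lemma norm_clif_of_real: "norm (clif_of_real r) = \<bar>r\<bar>"
  by (simp add: clif_of_real_def clif_basis_def)

text \<open>
  Adding the double sum to itself with the indices exchanged leaves only anticommutators, hence only
  the diagonal.
\<close>
lemma clif_vec_square: "clif_vec x \<odot> clif_vec x = clif_of_real (- (norm x)\<^sup>2)"
proof -
  let ?S = "\<Sum>i\<in>UNIV. \<Sum>j\<in>UNIV. (x $ i * x $ j) *\<^sub>R (clif_gen i \<odot> clif_gen j)"
  have S: "clif_vec x \<odot> clif_vec x = ?S"
    by (simp add: clif_vec_def clif_mult_sum_left clif_mult_sum_right clif_mult_linear
        scaleR_sum_right mult.commute) (subst sum.swap, simp add: mult.commute)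
  have anti: "clif_gen i \<odot> clif_gen j + clif_gen j \<odot> clif_gen i =
      (if i = j then -2 *\<^sub>R clif_basis {} else 0)" for i j :: 'a
    using clif_gen_square [of j] clif_gen_anticommute [of i j]
    by (auto simp: clif_of_real_def scaleR_2)
  have "?S + ?S = ?S + (\<Sum>i\<in>UNIV. \<Sum>j\<in>UNIV. (x $ i * x $ j) *\<^sub>R (clif_gen j \<odot> clif_gen i))"
    by (subst (2) sum.swap) (simp add: mult.commute)
  also have "\<dots> = (\<Sum>i\<in>UNIV. \<Sum>j\<in>UNIV. (x $ i * x $ j) *\<^sub>R
      (clif_gen i \<odot> clif_gen j + clif_gen j \<odot> clif_gen i))"
    by (simp add: sum.distrib scaleR_add_right)
  also have "\<dots> = (\<Sum>i\<in>UNIV. (- 2 * (x $ i)\<^sup>2) *\<^sub>R clif_basis {})"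
    unfolding anti by (intro sum.cong refl) (simp add: if_distrib power2_eq_square cong: if_cong)
  also have "\<dots> = (\<Sum>i\<in>UNIV. - 2 * (x $ i)\<^sup>2) *\<^sub>R clif_basis {}"
    by (rule scaleR_left.sum [symmetric])
  also have "(\<Sum>i\<in>UNIV. - 2 * (x $ i)\<^sup>2) = - 2 * (norm x)\<^sup>2"
    by (simp add: norm_vec_def L2_set_def sum_nonneg sum_distrib_left sum_negf)
  also have "(- 2 * (norm x)\<^sup>2) *\<^sub>R clif_basis {} = clif_of_real (- (norm x)\<^sup>2) + clif_of_real (- (norm x)\<^sup>2)"
    unfolding clif_of_real_def scaleR_add_left [symmetric] by simp
  finally have twice: "?S + ?S = clif_of_real (- (norm x)\<^sup>2) + clif_of_real (- (norm x)\<^sup>2)" .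
  have halve: "a = b" if "a + a = b + b" for a b :: "'a clifford"
  proof -
    have "2 *\<^sub>R a = 2 *\<^sub>R b" using that by (simp only: scaleR_2)
    then show ?thesis by simp
  qed
  show ?thesis unfolding S using twice by (rule halve)
qed

lemma bounded_linear_clif_mult_right: "bounded_linear (\<lambda>f. e \<odot> f)"
  using bilinear_clif_mult by (auto simp: bilinear_def linear_conv_bounded_linear)

lemma clif_vec_axis: "clif_vec (axis j 1) = clif_gen j"
  by (simp add: clif_vec_def axis_def if_distrib [of "\<lambda>t. t *\<^sub>R _"] cong: if_cong)

lemma bounded_linear_clif_vec: "bounded_linear clif_vec"
  unfolding linear_conv_bounded_linear [symmetric] clif_vec_def
  by (rule linearI) (simp_all add: algebra_simps sum.distrib scaleR_sum_right)

lemma bounded_linear_clif_of_real: "bounded_linear clif_of_real"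
  unfolding clif_of_real_def by (rule bounded_linear_scaleR_left)


section \<open>Partial derivatives and integration by parts\<close>
lemma partial_deriv_eq:
  assumes "(u has_derivative u') (at x)"
  shows "partial_deriv j u x = u' (axis j 1)"
proof -
  have "((\<lambda>t. x + t *\<^sub>R axis j 1) has_derivative (\<lambda>t. t *\<^sub>R axis j 1)) (at (0::real))"
    by (auto intro!: derivative_eq_intros)
  moreover have "(u has_derivative u') (at (x + 0 *\<^sub>R axis j 1))" using assms by simp
  ultimately have "((\<lambda>t. u (x + t *\<^sub>R axis j 1)) has_derivative (\<lambda>t. u' (t *\<^sub>R axis j 1))) (at (0::real))"
    by (rule has_derivative_compose)
  moreover have "u' (t *\<^sub>R axis j 1) = t *\<^sub>R u' (axis j 1)" for t
    using assms by (simp add: has_derivative_bounded_linear linear_simps)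
  ultimately have "((\<lambda>t. u (x + t *\<^sub>R axis j 1)) has_vector_derivative u' (axis j 1)) (at 0)"
    by (simp add: has_vector_derivative_def)
  then show ?thesis unfolding partial_deriv_def by (rule vector_derivative_at)
qed

lemma has_derivative_zero_outside:
  assumes "x \<notin> closure {y. u y \<noteq> 0}"
  shows "(u has_derivative (\<lambda>h. 0)) (at x)"
proof (rule has_derivative_transform_within_open)
  show "((\<lambda>y. 0) has_derivative (\<lambda>h. 0)) (at x)" by simp
  show "open (- closure {y. u y \<noteq> 0})" "x \<in> - closure {y. u y \<noteq> 0}" using assms by auto
  show "0 = u y" if "y \<in> - closure {y. u y \<noteq> 0}" for y
    using that closure_subset [of "{y. u y \<noteq> 0}"] by auto
qed

lemma partial_deriv_zero_outside:
  "x \<notin> closure {y. u y \<noteq> 0} \<Longrightarrow> partial_deriv j u x = 0"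
  using partial_deriv_eq [OF has_derivative_zero_outside] by metis

text \<open>
  All integrals of the weak formulation have integrands that are continuous on \<open>\<Omega>\<close> and supported in a
  compact \<open>K \<subseteq> \<Omega>\<close>; extension by zero then passes from \<open>lebesgue_on \<Omega>\<close> to Borel functions on the whole
  space. Continuity of the extension holds since the open sets \<open>\<Omega>\<close> and \<open>- K\<close> cover the space.
\<close>
lemma supported_extension:
  fixes h :: "'a::euclidean_space \<Rightarrow> 'b::euclidean_space"
  assumes "open \<Omega>" and cont: "continuous_on \<Omega> h" and "compact K" "K \<subseteq> \<Omega>"
    and zero: "\<And>x. x \<in> \<Omega> - K \<Longrightarrow> h x = 0"
  defines "h' \<equiv> \<lambda>x. if x \<in> \<Omega> then h x else 0"
  shows "continuous_on UNIV h'"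
    and "integrable lborel h'"
    and "integrable (lebesgue_on \<Omega>) h"
    and "integral\<^sup>L (lebesgue_on \<Omega>) h = integral\<^sup>L lborel h'"
proof -
  have "continuous_on (\<Omega> \<union> - K) h'"
  proof (rule continuous_on_open_Un)
    show "continuous_on \<Omega> h'"
      using cont by (rule continuous_on_eq) (simp add: h'_def)
    have "continuous_on (- K) (\<lambda>x. 0 :: 'b)" by simp
    then show "continuous_on (- K) h'"
      by (rule continuous_on_eq) (use zero in \<open>auto simp: h'_def\<close>)
    show "open \<Omega>" "open (- K)" using assms by (auto simp: compact_imp_closed)
  qed
  moreover have "\<Omega> \<union> - K = UNIV" using assms by auto
  ultimately show cont': "continuous_on UNIV h'" by simp
  have "integrable lborel (\<lambda>x. indicator K x *\<^sub>R h' x)"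
    using assms(3) continuous_on_subset [OF cont'] by (intro borel_integrable_compact) auto
  moreover have "(\<lambda>x. indicator K x *\<^sub>R h' x) = h'"
    using zero by (auto simp: h'_def fun_eq_iff indicator_def)
  ultimately show int': "integrable lborel h'" by simp
  have ext: "(\<lambda>x. indicator \<Omega> x *\<^sub>R h x) = h'"
    by (auto simp: h'_def fun_eq_iff indicator_def)
  have meas: "h' \<in> borel_measurable lborel"
    using int' by auto
  have \<Omega>: "\<Omega> \<inter> space lebesgue \<in> sets lebesgue" using \<open>open \<Omega>\<close> by auto
  show "integrable (lebesgue_on \<Omega>) h"
    unfolding integrable_restrict_space [OF \<Omega>] ext using int' meas
    by (simp add: integrable_completion)
  show "integral\<^sup>L (lebesgue_on \<Omega>) h = integral\<^sup>L lborel h'"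
    unfolding integral_restrict_space [OF \<Omega>] ext using meas by (simp add: integral_completion)
qed

lemma lborel_translate:
  fixes g :: "'a::euclidean_space \<Rightarrow> real"
  assumes "integrable lborel g"
  shows "integrable lborel (\<lambda>x. g (a + x))"
    and "(LINT x|lborel. g (a + x)) = integral\<^sup>L lborel g"
proof -
  have distr: "distr lborel borel ((+) a) = (lborel :: 'a measure)"
    using lborel_affine [of "1::real" a] by (simp add: density_1)
  have meas: "g \<in> borel_measurable borel" using assms by auto
  have g: "integrable (distr lborel borel ((+) a)) g" using assms distr by simp
  show "integrable lborel (\<lambda>x. g (a + x))"
    by (rule integrable_distr [OF _ g]) simp
  have "integral\<^sup>L (distr lborel borel ((+) a)) g = (LINT x|lborel. g (a + x))"
    by (rule integral_distr) (auto simp: meas)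
  then show "(LINT x|lborel. g (a + x)) = integral\<^sup>L lborel g" by (simp add: distr)
qed

text \<open>
  By translation invariance the difference quotients of \<open>g\<close> in direction \<open>e\<^sub>j\<close> have integral zero. They
  converge to \<open>\<partial>\<^sub>j g\<close>, and by the mean value theorem they are bounded by \<open>sup |\<partial>\<^sub>j g|\<close> on a fixed ball, so
  dominated convergence applies.
\<close>
lemma integral_partial_deriv_eq_0:
  fixes g :: "real ^ 'n::finite \<Rightarrow> real"
  assumes diff: "\<And>x. g differentiable (at x)"
    and cont: "continuous_on UNIV (partial_deriv j g)"
    and compact: "compact (closure {x. g x \<noteq> 0})"
  shows "integral\<^sup>L lborel (partial_deriv j g) = 0"
proof -
  define D where "D = partial_deriv j g"
  define e :: "real ^ 'n" where "e = axis j 1"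
  have norm_e: "norm e = 1" by (simp add: e_def)
  obtain R where R: "R > 0" "closure {x. g x \<noteq> 0} \<subseteq> ball 0 R"
    using bounded_subset_ballD compact compact_imp_bounded by metis
  have g0: "g x = 0" if "norm x \<ge> R" for x
    using R(2) that closure_subset [of "{x. g x \<noteq> 0}"] by force
  have D0: "D x = 0" if "norm x \<ge> R" for x
    unfolding D_def using that R by (intro partial_deriv_zero_outside) force
  have "compact (D ` cball 0 R)"
    using cont unfolding D_def by (intro compact_continuous_image continuous_on_subset [OF cont]) auto
  then have "bounded (D ` cball 0 R)" by (rule compact_imp_bounded)
  then obtain M where M0: "\<forall>y\<in>D ` cball 0 R. norm y \<le> M"
    unfolding bounded_iff ..
  have M: "\<bar>D x\<bar> \<le> \<bar>M\<bar>" for x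
  proof (cases "norm x \<le> R")
    case True
    then have "norm (D x) \<le> M" using M0 by simp
    then show ?thesis by simp
  next
    case False
    then show ?thesis using D0 [of x] by simp
  qed
  have line: "((\<lambda>t. g (x + t *\<^sub>R e)) has_real_derivative D (x + t *\<^sub>R e)) (at t)" for x t
  proof -
    obtain g' where g': "(g has_derivative g') (at (x + t *\<^sub>R e))"
      using diff unfolding differentiable_def by blast
    have "((\<lambda>t. x + t *\<^sub>R e) has_derivative (\<lambda>t. t *\<^sub>R e)) (at t)"
      by (auto intro!: derivative_eq_intros)
    then have "((\<lambda>t. g (x + t *\<^sub>R e)) has_derivative (\<lambda>t. g' (t *\<^sub>R e))) (at t)"
      using g' by (rule has_derivative_compose)
    moreover have "g' (s *\<^sub>R e) = s * D (x + t *\<^sub>R e)" for s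
      using has_derivative_bounded_linear [OF g'] partial_deriv_eq [OF g', of j]
      by (simp add: D_def e_def linear_simps)
    ultimately show ?thesis by (simp add: has_field_derivative_def mult_commute_abs)
  qed
  define d where "d = (\<lambda>k x. (g (x + (1 / real (Suc k)) *\<^sub>R e) - g x) * real (Suc k))"
  have cont_g: "continuous_on UNIV g"
    by (rule differentiable_imp_continuous_on) (use diff in \<open>auto simp: differentiable_on_def\<close>)
  have g_supp: "g x = 0" if "x \<in> UNIV - closure {x. g x \<noteq> 0}" for x
    using that closure_subset [of "{x. g x \<noteq> 0}"] by blast
  have int_g: "integrable lborel g"
    using supported_extension(2) [OF open_UNIV cont_g compact subset_UNIV g_supp] by simp
  have int_d: "integrable lborel (d k)" "integral\<^sup>L lborel (d k) = 0" for k
    using lborel_translate [OF int_g, of "(1 / real (Suc k)) *\<^sub>R e"] int_g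
    by (simp_all add: d_def add.commute)
  have "(\<lambda>k. integral\<^sup>L lborel (d k)) \<longlonglongrightarrow> integral\<^sup>L lborel D"
  proof (rule integral_dominated_convergence
      [where w = "\<lambda>x. \<bar>M\<bar> * indicator (cball 0 (R + 1)) x"])
    show "D \<in> borel_measurable lborel"
      using cont by (auto simp: D_def borel_measurable_continuous_onI)
    show "d k \<in> borel_measurable lborel" for k using int_d(1) by (rule borel_measurable_integrable)
    show "integrable lborel (\<lambda>x::real ^ 'n. \<bar>M\<bar> * indicator (cball 0 (R + 1)) x)"
      by (intro integrable_mult_right integrable_real_indicator emeasure_bounded_finite) simp_all
    show "AE x in lborel. (\<lambda>k. d k x) \<longlonglongrightarrow> D x"
    proof (intro AE_I2)
      fix x :: "real ^ 'n"
      have "((\<lambda>t. (g (x + t *\<^sub>R e) - g x) / t) \<longlongrightarrow> D x) (at 0)"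
        using line [of x 0] by (simp add: has_field_derivative_iff)
      moreover have "filterlim (\<lambda>k. 1 / real (Suc k)) (at 0) sequentially"
        by (rule filterlim_atI [OF LIMSEQ_Suc [OF lim_1_over_n]]) simp
      ultimately have
        "(\<lambda>k. (g (x + (1 / real (Suc k)) *\<^sub>R e) - g x) / (1 / real (Suc k))) \<longlonglongrightarrow> D x"
        by (rule filterlim_compose)
      then show "(\<lambda>k. d k x) \<longlonglongrightarrow> D x" by (simp add: d_def)
    qed
    show "AE x in lborel. norm (d k x) \<le> \<bar>M\<bar> * indicator (cball 0 (R + 1)) x" for k
    proof (intro AE_I2)
      fix x :: "real ^ 'n"
      define t where "t = 1 / real (Suc k)"
      have t: "0 < t" "t \<le> 1" by (auto simp: t_def)
      show "norm (d k x) \<le> \<bar>M\<bar> * indicator (cball 0 (R + 1)) x"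
      proof (cases "norm x \<le> R + 1")
        case True
        obtain z where "g (x + t *\<^sub>R e) - g (x + 0 *\<^sub>R e) = (t - 0) * D (x + z *\<^sub>R e)"
          using MVT2 [OF t(1) line, of x] by blast
        then have "d k x = D (x + z *\<^sub>R e)"
          by (simp add: d_def t_def)
        then show ?thesis using True M by simp
      next
        case False
        have "norm x \<le> norm (x + t *\<^sub>R e) + t"
          using norm_triangle_sub [of x "x + t *\<^sub>R e"] t by (simp add: norm_e)
        then have "g (x + t *\<^sub>R e) = 0" "g x = 0" using False t by (auto intro!: g0)
        then show ?thesis using False by (simp add: d_def t_def)
      qed
    qed
  qed
  then have "(\<lambda>k. 0) \<longlonglongrightarrow> integral\<^sup>L lborel D" by (simp add: int_d)
  then show ?thesis by (simp add: D_def LIMSEQ_const_iff)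
qed

lemma test_functionD:
  assumes "v \<in> test_functions \<Omega>"
  shows "v differentiable (at x)" and "continuous_on UNIV v" and "continuous_on UNIV (partial_deriv j v)"
    and "compact (closure {x. v x \<noteq> 0})" and "closure {x. v x \<noteq> 0} \<subseteq> \<Omega>"
proof -
  have "C_k (Suc 0) v" "C_k 0 v" using assms unfolding test_functions_def by blast+
  then show "v differentiable (at x)" "continuous_on UNIV v" "continuous_on UNIV (partial_deriv j v)"
    by auto
qed (use assms in \<open>auto simp: test_functions_def\<close>)

lemma continuous_on_dirac:
  "(\<And>j. continuous_on S (partial_deriv j u)) \<Longrightarrow> continuous_on S (dirac u)"
  unfolding dirac_def
  by (intro continuous_on_sum bounded_linear.continuous_on [OF bounded_linear_clif_mult_right])

text \<open>
  Since the generators are skew-adjoint, \<open>\<langle>u, D v\<rangle> - \<langle>D u, v\<rangle>\<close> is the divergence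
  \<open>\<Sum>j. \<partial>\<^sub>j \<langle>u, e\<^sub>j v\<rangle>\<close>, and each term, extended by zero, is a partial derivative of a compactly supported
  \<open>C\<^sup>1\<close> function.
\<close>
lemma classical_imp_weak_dirac_solution:
  fixes u :: "real ^ 'n::{finite,linorder} \<Rightarrow> 'n clifford"
  assumes "open \<Omega>"
    and diff: "\<And>x. x \<in> \<Omega> \<Longrightarrow> u differentiable (at x)"
    and cont: "\<And>j. continuous_on \<Omega> (partial_deriv j u)"
    and eq: "\<And>x. x \<in> \<Omega> \<Longrightarrow> dirac u x = f x"
  shows "weak_dirac_solution \<Omega> f u"
  unfolding weak_dirac_solution_def
proof
  fix v :: "real ^ 'n::{finite,linorder} \<Rightarrow> 'n clifford"
  assume v: "v \<in> test_functions \<Omega>"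
  define K where "K = closure {x. v x \<noteq> 0}"
  note vD = test_functionD [OF v]
  have K: "compact K" "K \<subseteq> \<Omega>" using vD by (auto simp: K_def)
  have v0: "v x = 0" if "x \<notin> K" for x
    using that closure_subset [of "{x. v x \<noteq> 0}"] unfolding K_def by blast
  have dv0: "partial_deriv j v x = 0" if "x \<notin> K" for x j
    using that unfolding K_def by (rule partial_deriv_zero_outside)
  have cu: "continuous_on \<Omega> u"
    by (rule differentiable_imp_continuous_on)
      (use diff in \<open>auto simp: differentiable_on_def intro: differentiable_at_withinI\<close>)
  have cf: "continuous_on \<Omega> f"
  proof (rule continuous_on_eq)
    show "continuous_on \<Omega> (dirac u)" using cont by (rule continuous_on_dirac)
  qed (use eq in auto)
  have cv: "continuous_on \<Omega> v" "\<And>j. continuous_on \<Omega> (partial_deriv j v)"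
    using vD continuous_on_subset by blast+
  have cDv: "continuous_on \<Omega> (dirac v)" using cv(2) by (rule continuous_on_dirac)
  have Dv0: "dirac v x = 0" if "x \<notin> K" for x
    using dv0 [OF that] by (simp add: dirac_def linear_simps bounded_linear_clif_mult_right)
  have zero_mult: "e \<odot> 0 = 0" for e :: "'n clifford"
    by (simp add: linear_simps bounded_linear_clif_mult_right)
  \<comment> \<open>\<open>q j\<close> is \<open>\<partial>\<^sub>j \<langle>u, e\<^sub>j v\<rangle>\<close> by the product rule.\<close>
  define q where "q = (\<lambda>j x. partial_deriv j u x \<bullet> (clif_gen j \<odot> v x)
      + u x \<bullet> (clif_gen j \<odot> partial_deriv j v x))"
  have cq: "continuous_on \<Omega> (q j)" for j
    unfolding q_def
    by (intro continuous_on_add continuous_on_inner cu cont cv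
        bounded_linear.continuous_on [OF bounded_linear_clif_mult_right])
  have q0: "q j x = 0" if "x \<notin> K" for j x
    using v0 [OF that] dv0 [OF that] by (simp add: q_def zero_mult)
  have int_q: "integral\<^sup>L (lebesgue_on \<Omega>) (q j) = 0" for j
  proof -
    define g where "g = (\<lambda>x. if x \<in> \<Omega> then u x \<bullet> (clif_gen j \<odot> v x) else 0)"
    have supp: "closure {x. g x \<noteq> 0} \<subseteq> K"
      unfolding K_def by (intro closure_mono) (auto simp: g_def zero_mult)
    have deriv: "g differentiable (at x) \<and> partial_deriv j g x = (if x \<in> \<Omega> then q j x else 0)" for x
    proof (cases "x \<in> \<Omega>")
      case True
      obtain u' where u': "(u has_derivative u') (at x)"
        using diff True unfolding differentiable_def by blast
      obtain v' where v': "(v has_derivative v') (at x)"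
        using vD(1) unfolding differentiable_def by blast
      have "((\<lambda>x. u x \<bullet> (clif_gen j \<odot> v x)) has_derivative
          (\<lambda>h. u x \<bullet> (clif_gen j \<odot> v' h) + u' h \<bullet> (clif_gen j \<odot> v x))) (at x)"
        by (intro has_derivative_inner u'
            bounded_linear.has_derivative [OF bounded_linear_clif_mult_right] v')
      then have g': "(g has_derivative
          (\<lambda>h. u x \<bullet> (clif_gen j \<odot> v' h) + u' h \<bullet> (clif_gen j \<odot> v x))) (at x)"
        by (rule has_derivative_transform_within_open [OF _ \<open>open \<Omega>\<close> True]) (simp add: g_def)
      from partial_deriv_eq [OF g', of j] True show ?thesis
        unfolding q_def partial_deriv_eq [OF u', of j] partial_deriv_eq [OF v', of j]
        using g' by (auto simp: differentiable_def)
    next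
      case False
      then have "x \<notin> closure {x. g x \<noteq> 0}" using supp K by auto
      from has_derivative_zero_outside [OF this] partial_deriv_zero_outside [OF this]
      show ?thesis using False by (auto simp: differentiable_def)
    qed
    have q: "partial_deriv j g = (\<lambda>x. if x \<in> \<Omega> then q j x else 0)" using deriv by auto
    have "compact (closure {x. g x \<noteq> 0})"
      using supp compact_Int_closed [OF K(1) closed_closure, of "{x. g x \<noteq> 0}"]
      by (simp only: Int_absorb1)
    moreover have q0': "q j x = 0" if "x \<in> \<Omega> - K" for x using that q0 by simp
    note ext = supported_extension [OF \<open>open \<Omega>\<close> cq K q0', folded q]
    ultimately have "integral\<^sup>L lborel (partial_deriv j g) = 0"
      using deriv ext(1) by (intro integral_partial_deriv_eq_0) simp_all
    then show ?thesis using ext(4) by simp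
  qed
  have ints: "integrable (lebesgue_on \<Omega>) (\<lambda>x. f x \<bullet> v x)"
    "integrable (lebesgue_on \<Omega>) (\<lambda>x. u x \<bullet> dirac v x)"
    "\<And>j. integrable (lebesgue_on \<Omega>) (q j)"
    by (rule supported_extension(3) [OF \<open>open \<Omega>\<close> _ K];
        (intro continuous_on_inner cf cu cv cDv cq)?; simp add: v0 Dv0 q0)+
  have "(LINT x|lebesgue_on \<Omega>. u x \<bullet> dirac v x) - (LINT x|lebesgue_on \<Omega>. f x \<bullet> v x)
      = (LINT x|lebesgue_on \<Omega>. u x \<bullet> dirac v x - f x \<bullet> v x)"
    using ints by simp
  also have "\<dots> = (LINT x|lebesgue_on \<Omega>. (\<Sum>j\<in>UNIV. q j x))"
  proof (rule Bochner_Integration.integral_cong [OF refl])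
    fix x assume "x \<in> space (lebesgue_on \<Omega>)"
    then have "f x = dirac u x" using eq by simp
    then show "u x \<bullet> dirac v x - f x \<bullet> v x = (\<Sum>j\<in>UNIV. q j x)"
      by (simp add: dirac_def q_def inner_sum_left inner_sum_right clif_inner_gen
          sum.distrib sum_negf)
  qed
  also have "\<dots> = 0" using ints int_q by simp
  finally show "(LINT x|lebesgue_on \<Omega>. f x \<bullet> v x) = (LINT x|lebesgue_on \<Omega>. u x \<bullet> dirac v x)"
    by simp
qed

section \<open>Smooth bumps in the variable \<open>ln |x|\<close>\<close>

text \<open>
  For \<open>i = 0\<close> this is the standard smooth function that is flat at \<open>0\<close>. The negative powers of \<open>x\<close> are
  included because the derivatives of the case \<open>i = 0\<close> are combinations of the functions \<open>flat p i\<close>.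
\<close>
definition flat :: "real \<Rightarrow> nat \<Rightarrow> real \<Rightarrow> real" where
  "flat p i x = (if 0 < x then exp (- p / x) * inverse x ^ i else 0)"

lemma power_le_fact_exp:
  fixes y :: real
  assumes "0 \<le> y"
  shows "y ^ i \<le> fact i * exp y"
proof -
  have "(\<Sum>k\<in>{i}. inverse (fact k) * y ^ k) \<le> (\<Sum>k. inverse (fact k) * y ^ k)"
    using assms summable_exp [of y] by (intro sum_le_suminf) auto
  also have "\<dots> = exp y" by (simp add: exp_def)
  finally show ?thesis by (simp add: field_simps)
qed

lemma flat_bounded:
  assumes "0 < p"
  shows "\<bar>flat p i x\<bar> \<le> fact i / p ^ i"
proof (cases "0 < x")
  case True
  have "(p / x) ^ i \<le> fact i * exp (p / x)"
    using assms True by (intro power_le_fact_exp) auto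
  then show ?thesis
    using assms True by (simp add: flat_def field_simps exp_minus)
qed (use assms in \<open>simp add: flat_def\<close>)

text \<open>
  At \<open>x = 0\<close> the identity \<open>flat p i h = h\<^sup>2 * flat p (i + 2) h\<close> and boundedness of the last factor make
  the difference quotient \<open>O(h)\<close>.
\<close>
lemma flat_has_derivative:
  assumes "0 < p"
  shows "(flat p i has_real_derivative p * flat p (i + 2) x - real i * flat p (i + 1) x) (at x)"
proof -
  consider "0 < x" | "x < 0" | "x = 0" by linarith
  then show ?thesis
  proof cases
    case 1
    have 1: "((\<lambda>x. exp (- p / x)) has_real_derivative exp (- p / x) * (p * (inverse x)\<^sup>2)) (at x)"
      using \<open>0 < x\<close> by (auto intro!: derivative_eq_intros simp: field_simps power2_eq_square)
    have 2: "((\<lambda>x. inverse x ^ i) has_real_derivative - (real i * inverse x ^ (i + 1))) (at x)"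
      using DERIV_power [OF DERIV_inverse [OF less_imp_neq [OF \<open>0 < x\<close>, symmetric]], of i]
      by (cases i) (simp_all add: mult.assoc)
    have "((\<lambda>x. exp (- p / x) * inverse x ^ i) has_real_derivative
        p * flat p (i + 2) x - real i * flat p (i + 1) x) (at x)"
      by (rule DERIV_cong [OF DERIV_mult [OF 1 2]])
        (use \<open>0 < x\<close> in \<open>simp add: flat_def power_add power2_eq_square algebra_simps\<close>)
    then show ?thesis
      by (rule has_field_derivative_transform_within_open [where S = "{0<..}"])
        (use \<open>0 < x\<close> in \<open>auto simp: flat_def\<close>)
  next
    case 2
    have "((\<lambda>x. 0) has_real_derivative p * flat p (i + 2) x - real i * flat p (i + 1) x) (at x)"
      using 2 by (simp add: flat_def)
    then show ?thesis
      by (rule has_field_derivative_transform_within_open [where S = "{..<0}"])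
        (use 2 in \<open>auto simp: flat_def\<close>)
  next
    case 3
    have "((\<lambda>h. (flat p i h - flat p i 0) / h) \<longlongrightarrow> 0) (at 0)"
    proof (rule Lim_null_comparison)
      show "eventually (\<lambda>h. norm ((flat p i h - flat p i 0) / h) \<le> \<bar>h\<bar> * (fact (i + 2) / p ^ (i + 2))) (at 0)"
      proof (intro always_eventually allI)
        fix h :: real
        have "h * (inverse h * (inverse h * r)) = r * inverse h" for r by (cases "h = 0") auto
        then have "(flat p i h - flat p i 0) / h = h * flat p (i + 2) h"
          by (simp add: flat_def divide_inverse mult.left_commute [of h "exp _"]
              mult.assoc)
        then show "norm ((flat p i h - flat p i 0) / h) \<le> \<bar>h\<bar> * (fact (i + 2) / p ^ (i + 2))"
          using mult_left_mono [OF flat_bounded [OF assms, of "i + 2" h] abs_ge_zero [of h]]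
          by (simp only: real_norm_def abs_mult)
      qed
      show "((\<lambda>h. \<bar>h\<bar> * (fact (i + 2) / p ^ (i + 2))) \<longlongrightarrow> 0) (at 0)"
        using assms by (auto intro!: tendsto_eq_intros)
    qed
    then show ?thesis using 3 by (simp add: has_field_derivative_iff flat_def)
  qed
qed

text \<open>
  Smooth functions on the line supported in \<open>[a, b]\<close>, collected in a span that is visibly closed under
  differentiation, so that infinitely many derivatives never have to be computed. The factors
  \<open>exp (c * s)\<close> provide the powers \<open>|x|\<^sup>c\<close> once \<open>s = ln |x|\<close> is substituted.
\<close>
inductive bump_span :: "real \<Rightarrow> real \<Rightarrow> real \<Rightarrow> real \<Rightarrow> (real \<Rightarrow> real) \<Rightarrow> bool"
  for a b p q where
  base: "bump_span a b p q (\<lambda>s. flat p i (s - a) * flat q j (b - s) * exp (c * s))"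
| add: "bump_span a b p q G \<Longrightarrow> bump_span a b p q H \<Longrightarrow> bump_span a b p q (\<lambda>s. G s + H s)"
| scale: "bump_span a b p q G \<Longrightarrow> bump_span a b p q (\<lambda>s. r * G s)"

lemma bump_span_zero:
  assumes "bump_span a b p q G" "s \<le> a \<or> b \<le> s"
  shows "G s = 0"
  using assms by induction (auto simp: flat_def)

lemma bump_span_exp: "bump_span a b p q G \<Longrightarrow> bump_span a b p q (\<lambda>s. G s * exp (c * s))"
proof (induction rule: bump_span.induct)
  case (base i j d)
  have "(\<lambda>s. flat p i (s - a) * flat q j (b - s) * exp (d * s) * exp (c * s)) =
      (\<lambda>s. flat p i (s - a) * flat q j (b - s) * exp ((d + c) * s))"
    by (simp add: distrib_right exp_add mult.assoc)
  then show ?case using bump_span.base by metis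
next
  case (add G H)
  from bump_span.add [OF this(3,4)] show ?case by (simp add: distrib_right)
next
  case (scale G r)
  from bump_span.scale [OF this(2), of r] show ?case by (simp add: mult.assoc)
qed

lemma bump_span_deriv:
  assumes "bump_span a b p q G" "0 < p" "0 < q"
  shows "\<exists>G'. (\<forall>s. (G has_real_derivative G' s) (at s)) \<and> bump_span a b p q G'"
  using assms(1)
proof induction
  case (base i j c)
  let ?B = "\<lambda>i j s. flat p i (s - a) * flat q j (b - s) * exp (c * s)"
  let ?G' = "\<lambda>s. (p * ?B (i + 2) j s + (- real i) * ?B (i + 1) j s) +
      ((- q) * ?B i (j + 2) s + real j * ?B i (j + 1) s) + c * ?B i j s"
  have "(?B i j has_real_derivative ?G' s) (at s)" for s
  proof -
    have 1: "((\<lambda>s. flat p i (s - a)) has_real_derivative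
        (p * flat p (i + 2) (s - a) - real i * flat p (i + 1) (s - a)) * 1) (at s)"
      by (rule DERIV_chain2 [OF flat_has_derivative [OF assms(2)]]) (auto intro!: derivative_eq_intros)
    have 2: "((\<lambda>s. flat q j (b - s)) has_real_derivative
        (q * flat q (j + 2) (b - s) - real j * flat q (j + 1) (b - s)) * (- 1)) (at s)"
      by (rule DERIV_chain2 [OF flat_has_derivative [OF assms(3)]]) (auto intro!: derivative_eq_intros)
    have 3: "((\<lambda>s. exp (c * s)) has_real_derivative c * exp (c * s)) (at s)"
      by (auto intro!: derivative_eq_intros)
    show ?thesis
      by (rule DERIV_cong [OF DERIV_mult [OF DERIV_mult [OF 1 2] 3]]) (simp add: algebra_simps)
  qed
  moreover have "bump_span a b p q ?G'" by (intro bump_span.intros)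
  ultimately show ?case by (intro exI [of _ ?G'] conjI allI)
next
  case (add G H)
  then obtain G' H' where "\<And>s. (G has_real_derivative G' s) (at s)" "bump_span a b p q G'"
    "\<And>s. (H has_real_derivative H' s) (at s)" "bump_span a b p q H'" by blast
  then show ?case by (intro exI [of _ "\<lambda>s. G' s + H' s"]) (auto intro: bump_span.add DERIV_add)
next
  case (scale G r)
  then obtain G' where "\<And>s. (G has_real_derivative G' s) (at s)" "bump_span a b p q G'" by blast
  then show ?case by (intro exI [of _ "\<lambda>s. r * G' s"]) (auto intro: bump_span.scale DERIV_cmult)
qed

lemma has_derivative_ln_norm:
  fixes x :: "'a::real_inner"
  assumes "x \<noteq> 0"
  shows "((\<lambda>x. ln (norm x)) has_derivative (\<lambda>h. exp (- 2 * ln (norm x)) * (x \<bullet> h))) (at x)"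
proof -
  have "0 < norm x" using assms by simp
  from has_derivative_compose [OF has_derivative_norm [OF assms]
      DERIV_ln [OF this, unfolded has_field_derivative_def]]
  have "((\<lambda>x. ln (norm x)) has_derivative (\<lambda>h. inverse (norm x) * (h \<bullet> sgn x))) (at x)" .
  moreover have "exp (- 2 * ln (norm x)) = 1 / (norm x)\<^sup>2"
    using assms by (simp add: exp_minus exp_double field_simps)
  ultimately show ?thesis
    by (simp add: sgn_div_norm power2_eq_square inner_commute divide_inverse mult_ac)
qed

text \<open>
  The hypothesis \<open>0 < a\<close> covers the origin: nearby \<open>ln |y| < 0\<close>, and at the origin itself the default
  value \<open>ln 0 = 0\<close> is also below \<open>a\<close>, so the function vanishes in a neighbourhood.
\<close>
lemma has_derivative_radial_bump:
  fixes x :: "'a::real_inner"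
  assumes "bump_span a b p q G" "0 < a" and G': "\<And>s. (G has_real_derivative G' s) (at s)"
    and "bump_span a b p q G'"
  shows "((\<lambda>x. G (ln (norm x))) has_derivative
      (\<lambda>h. G' (ln (norm x)) * exp (- 2 * ln (norm x)) * (x \<bullet> h))) (at x)"
proof (cases "x = 0")
  case False
  from has_derivative_compose [OF has_derivative_ln_norm [OF False]
      G' [unfolded has_field_derivative_def]]
  show ?thesis by (simp add: mult.assoc)
next
  case True
  have zero: "G (ln (norm y)) = 0" if "norm y < 1" for y :: 'a
  proof (cases "y = 0")
    case False
    then have "ln (norm y) < 0" using that by simp
    then show ?thesis using assms(1,2) by (intro bump_span_zero [of a b p q G]) auto
  qed (use assms(1,2) in \<open>auto intro!: bump_span_zero [of a b p q G]\<close>)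
  have "((\<lambda>x. G (ln (norm x))) has_derivative (\<lambda>h. 0)) (at x)"
    by (rule has_derivative_transform_within_open [OF has_derivative_const open_ball, of x 0 1])
      (use True zero in auto)
  then show ?thesis using True by simp
qed

text \<open>
  The same device on \<open>\<real>\<^sup>n\<close>: since \<open>\<partial>\<^sub>j (G(ln |x|)) = x\<^sub>j |x|\<^sup>-\<^sup>2 G'(ln |x|)\<close>, closing the radial functions under
  multiplication by coordinates yields a class that is stable under all partial derivatives.
\<close>
inductive radial_bump :: "real \<Rightarrow> real \<Rightarrow> real \<Rightarrow> real \<Rightarrow>
    (real ^ 'n::finite \<Rightarrow> 'b::real_normed_vector) \<Rightarrow> bool"
  for a b p q where
  radial: "bump_span a b p q G \<Longrightarrow> radial_bump a b p q (\<lambda>x. G (ln (norm x)) *\<^sub>R c)"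
| sum: "radial_bump a b p q g \<Longrightarrow> radial_bump a b p q h \<Longrightarrow> radial_bump a b p q (\<lambda>x. g x + h x)"
| coord: "radial_bump a b p q g \<Longrightarrow> radial_bump a b p q (\<lambda>x. x $ j *\<^sub>R g x)"

lemma radial_bump_zero: "radial_bump a b p q (\<lambda>x. 0)"
  using radial_bump.radial [OF bump_span.base, where c = 0] by simp

lemma radial_bump_partial_deriv:
  fixes g :: "real ^ 'n::finite \<Rightarrow> 'b::real_normed_vector"
  assumes "radial_bump a b p q g" "0 < a" "0 < p" "0 < q"
  shows "(\<forall>x. g differentiable (at x)) \<and> radial_bump a b p q (partial_deriv j g)"
  using assms(1)
proof induction
  case (radial G c)
  obtain G' where G': "\<And>s. (G has_real_derivative G' s) (at s)" "bump_span a b p q G'"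
    using bump_span_deriv [OF radial assms(3,4)] by blast
  have deriv: "((\<lambda>x. G (ln (norm x)) *\<^sub>R c) has_derivative
      (\<lambda>h. (G' (ln (norm x)) * exp (- 2 * ln (norm x)) * (x \<bullet> h)) *\<^sub>R c)) (at x)" for x :: "real ^ 'n"
    by (intro has_derivative_scaleR_left has_derivative_radial_bump [OF radial assms(2) G'])
  have "partial_deriv j (\<lambda>x. G (ln (norm x)) *\<^sub>R c) =
      (\<lambda>x. x $ j *\<^sub>R (G' (ln (norm x)) * exp (- 2 * ln (norm x))) *\<^sub>R c)"
    by (simp add: fun_eq_iff partial_deriv_eq [OF deriv] inner_axis mult.commute)
  moreover have "radial_bump a b p q (\<lambda>x. x $ j *\<^sub>R (G' (ln (norm x)) * exp (- 2 * ln (norm x))) *\<^sub>R c)"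
    by (intro radial_bump.coord radial_bump.radial [of _ _ _ _ "\<lambda>s. G' s * exp (- 2 * s)"]
        bump_span_exp G')
  ultimately show ?case using deriv unfolding differentiable_def by auto
next
  case (sum g h)
  have "partial_deriv j (\<lambda>x. g x + h x) x = partial_deriv j g x + partial_deriv j h x" for x
  proof -
    obtain g' h' where d: "(g has_derivative g') (at x)" "(h has_derivative h') (at x)"
      using sum.IH unfolding differentiable_def by blast
    show ?thesis
      by (simp add: partial_deriv_eq [OF d(1)] partial_deriv_eq [OF d(2)]
          partial_deriv_eq [OF has_derivative_add [OF d]])
  qed
  then have "partial_deriv j (\<lambda>x. g x + h x) = (\<lambda>x. partial_deriv j g x + partial_deriv j h x)" ..
  then show ?case using sum.IH by (auto intro: radial_bump.sum)
next
  case (coord g i)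
  have d: "((\<lambda>x. x $ i *\<^sub>R g x) has_derivative (\<lambda>h. x $ i *\<^sub>R g' h + h $ i *\<^sub>R g x)) (at x)"
    if "(g has_derivative g') (at x)" for x g'
    by (intro has_derivative_scaleR that bounded_linear_imp_has_derivative bounded_linear_vec_nth)
  have eq: "partial_deriv j (\<lambda>x. x $ i *\<^sub>R g x) x =
      x $ i *\<^sub>R partial_deriv j g x + (if i = j then g x else 0)" for x
  proof -
    obtain g' where g': "(g has_derivative g') (at x)"
      using coord.IH unfolding differentiable_def by blast
    show ?thesis
      by (simp add: partial_deriv_eq [OF g'] partial_deriv_eq [OF d [OF g']] axis_def)
  qed
  have "radial_bump a b p q (\<lambda>x. if i = j then g x else 0)"
    using coord.hyps radial_bump_zero by (cases "i = j") auto
  then have "radial_bump a b p q (\<lambda>x. x $ i *\<^sub>R partial_deriv j g x + (if i = j then g x else 0))"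
    using coord.IH by (intro radial_bump.sum radial_bump.coord) auto
  moreover have "(\<lambda>x. x $ i *\<^sub>R g x) differentiable (at x)" for x
    using coord.IH d unfolding differentiable_def by blast
  ultimately show ?case using eq by (simp add: fun_eq_iff [symmetric] ext)
qed

lemma radial_bump_C_k:
  fixes g :: "real ^ 'n::finite \<Rightarrow> 'b::real_normed_vector"
  assumes "radial_bump a b p q g" "0 < a" "0 < p" "0 < q"
  shows "C_k k g"
  using assms(1)
proof (induction k arbitrary: g)
  case 0
  then have "g differentiable (at x)" for x
    using radial_bump_partial_deriv assms by blast
  then show ?case
    by (simp add: differentiable_imp_continuous_on differentiable_on_def)
next
  case (Suc k)
  from radial_bump_partial_deriv [OF Suc.prems assms(2-4)] Suc.IH show ?case by auto
qed

lemma radial_bump_sum: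
  "finite I \<Longrightarrow> (\<And>i. i \<in> I \<Longrightarrow> radial_bump a b p q (g i)) \<Longrightarrow> radial_bump a b p q (\<lambda>x. \<Sum>i\<in>I. g i x)"
proof (induction I rule: finite_induct)
  case empty
  then show ?case by (simp add: radial_bump_zero)
next
  case (insert i I)
  then show ?case by (simp add: radial_bump.sum)
qed

text \<open>
  The support lies in the annulus \<open>exp a \<le> |x| \<le> exp b\<close>, which avoids the closed unit ball as \<open>0 < a\<close>.
\<close>
lemma radial_vector_field_test_function:
  assumes "bump_span a b p q G" "0 < a" "0 < p" "0 < q"
  shows "(\<lambda>x :: real ^ 'n::{finite,linorder}. G (ln (norm x)) *\<^sub>R clif_vec x) \<in> test_functions (- cball 0 1)"
    (is "?v \<in> _")
proof -
  have "?v = (\<lambda>x. \<Sum>j\<in>UNIV. x $ j *\<^sub>R (G (ln (norm x)) *\<^sub>R clif_gen j))"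
    by (simp add: clif_vec_def scaleR_sum_right mult.commute)
  moreover have "radial_bump a b p q (\<lambda>x :: real ^ 'n::{finite,linorder}. \<Sum>j\<in>UNIV. x $ j *\<^sub>R (G (ln (norm x)) *\<^sub>R clif_gen j))"
    by (intro radial_bump_sum radial_bump.coord radial_bump.radial assms) simp
  ultimately have smooth: "C_k k ?v" for k using assms by (metis radial_bump_C_k)
  let ?K = "{x :: real ^ 'n::{finite,linorder}. exp a \<le> norm x \<and> norm x \<le> exp b}"
  have "closed ?K"
    by (intro closed_Collect_conj closed_Collect_le continuous_intros)
  moreover have "{x. ?v x \<noteq> 0} \<subseteq> ?K"
  proof
    fix x assume "x \<in> {x. ?v x \<noteq> 0}"
    then have "G (ln (norm x)) \<noteq> 0" "clif_vec x \<noteq> 0" by auto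
    then have "a < ln (norm x)" "ln (norm x) < b" "x \<noteq> 0"
      using bump_span_zero [OF assms(1), of "ln (norm x)"] norm_clif_vec [of x] by fastforce+
    then show "x \<in> ?K"
      by (simp add: ln_ge_iff less_imp_le) (metis exp_le_cancel_iff exp_ln less_imp_le zero_less_norm_iff)
  qed
  ultimately have supp: "closure {x. ?v x \<noteq> 0} \<subseteq> ?K" by (rule closure_minimal [rotated])
  have "bounded ?K" by (auto simp: bounded_iff)
  then have "compact (closure {x. ?v x \<noteq> 0})"
    using supp bounded_subset by (auto simp: compact_eq_bounded_closed)
  moreover have "?K \<subseteq> - cball 0 1"
    using assms(2) one_less_exp_iff [of a] by (auto simp del: one_less_exp_iff)
  ultimately show ?thesis using smooth supp by (auto simp: test_functions_def)
qed

text \<open>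
  Differentiating the factor \<open>x\<close> gives \<open>\<Sum>j. e\<^sub>j e\<^sub>j = - n\<close>, and differentiating the radial factor gives
  \<open>|x|\<^sup>-\<^sup>2 G'(s) x x = - G'(s)\<close>. For \<open>G(s) = e\<^sup>-\<^sup>n\<^sup>s P(s)\<close> the sum collapses to \<open>- e\<^sup>-\<^sup>n\<^sup>s P'(s)\<close>.
\<close>
lemma dirac_radial_vector_field:
  fixes x :: "real ^ 'n::{finite,linorder}"
  assumes G: "bump_span a b p q G" and pos: "0 < a" "0 < p" "0 < q"
    and d: "(G has_real_derivative d) (at (ln (norm x)))"
  shows "dirac (\<lambda>x. G (ln (norm x)) *\<^sub>R clif_vec x) x =
      clif_of_real (- (real CARD('n) * G (ln (norm x)) + d))"
proof -
  obtain G' where G': "\<And>s. (G has_real_derivative G' s) (at s)" "bump_span a b p q G'"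
    using bump_span_deriv [OF G pos(2,3)] by blast
  have d_eq: "d = G' (ln (norm x))" using d G'(1) by (rule DERIV_unique)
  let ?s = "ln (norm x)"
  define E where "E = exp (- 2 * ?s)"
  let ?v = "\<lambda>x :: real ^ 'n::{finite,linorder}. G (ln (norm x)) *\<^sub>R clif_vec x"
  have "(?v has_derivative
      (\<lambda>h. G ?s *\<^sub>R clif_vec h + (G' ?s * E * (x \<bullet> h)) *\<^sub>R clif_vec x)) (at x)"
    unfolding E_def
    by (intro has_derivative_scaleR has_derivative_radial_bump [OF G pos(1) G']
        bounded_linear_imp_has_derivative bounded_linear_clif_vec)
  note partial = partial_deriv_eq [OF this, unfolded clif_vec_axis inner_axis]
  have "dirac ?v x = G ?s *\<^sub>R (\<Sum>j\<in>UNIV. clif_gen j \<odot> clif_gen j)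
      + (G' ?s * E) *\<^sub>R ((\<Sum>j\<in>UNIV. x $ j *\<^sub>R clif_gen j) \<odot> clif_vec x)"
    by (simp add: dirac_def partial clif_mult_linear bilinear_radd [OF bilinear_clif_mult] clif_mult_sum_left sum.distrib
        scaleR_sum_right)
  also have "(\<Sum>j\<in>UNIV. x $ j *\<^sub>R clif_gen j) \<odot> clif_vec x = clif_of_real (- (norm x)\<^sup>2)"
    using clif_vec_square [of x] by (simp add: clif_vec_def)
  also have "(G' ?s * E) *\<^sub>R clif_of_real (- (norm x)\<^sup>2) = (clif_of_real (- G' ?s) :: 'n clifford)"
  proof (cases "x = 0")
    case True
    then have "G' ?s = 0" using G'(2) pos(1) by (intro bump_span_zero) auto
    then show ?thesis by (simp add: clif_of_real_def)
  next
    case False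
    then have "E * (norm x)\<^sup>2 = 1"
      by (simp add: E_def exp_minus exp_double)
    then show ?thesis by (simp add: clif_of_real_def mult.assoc)
  qed
  finally show ?thesis
    unfolding d_eq
    by (simp only: clif_gen_square sum_constant_scaleR clif_of_real_def)
      (simp add: mult.commute algebra_simps flip: scaleR_add_left)
qed

section \<open>An integrable weight of logarithmic decay\<close>

text \<open>
  On the annulus \<open>e\<^sup>k \<le> |x| < e\<^sup>k\<^sup>+\<^sup>1\<close> the integrand is at most \<open>e\<^sup>-\<^sup>n\<^sup>k (1 + k)\<^sup>-\<^sup>2\<close>, and the annulus has volume at
  most a constant times \<open>e\<^sup>n\<^sup>(\<^sup>k\<^sup>+\<^sup>1\<^sup>)\<close>. The exponentials cancel and \<open>\<Sum>k. (1 + k)\<^sup>-\<^sup>2\<close> remains.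
\<close>
lemma log_weight_nn_integral_finite:
  "(\<integral>\<^sup>+x\<in>{x :: 'a::euclidean_space. 1 < norm x}.
      ennreal (exp (- real DIM('a) * ln (norm x)) / (1 + ln (norm x))\<^sup>2) \<partial>lborel) < \<infinity>"
proof -
  let ?n = "DIM('a)"
  define V where "V = unit_ball_vol (real ?n)"
  define c where "c = (\<lambda>k. exp (- real ?n * real k) / (1 + real k)\<^sup>2)"
  have V: "0 \<le> V" by (simp add: V_def)
  have "(\<integral>\<^sup>+x\<in>{x :: 'a. 1 < norm x}. ennreal (exp (- real ?n * ln (norm x)) / (1 + ln (norm x))\<^sup>2) \<partial>lborel)
      \<le> (\<integral>\<^sup>+x. (\<Sum>k. ennreal (c k) * indicator (cball (0 :: 'a) (exp (real k + 1))) x) \<partial>lborel)"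
  proof (rule nn_integral_mono)
    fix x :: 'a
    show "ennreal (exp (- real ?n * ln (norm x)) / (1 + ln (norm x))\<^sup>2) * indicator {x. 1 < norm x} x
        \<le> (\<Sum>k. ennreal (c k) * indicator (cball 0 (exp (real k + 1))) x)"
    proof (cases "1 < norm x")
      case True
      define k where "k = nat \<lfloor>ln (norm x)\<rfloor>"
      have "0 < ln (norm x)" using True by (rule ln_gt_zero)
      then have k: "real k \<le> ln (norm x)" "ln (norm x) < real k + 1"
        by (simp_all add: k_def)
      then have "exp (ln (norm x)) \<le> exp (real k + 1)" by (simp only: exp_le_cancel_iff)
      moreover have "exp (ln (norm x)) = norm x" using True by (simp only: exp_ln)
      ultimately have mem: "x \<in> cball 0 (exp (real k + 1))" by simp
      have "exp (- real ?n * ln (norm x)) / (1 + ln (norm x))\<^sup>2 \<le> c k"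
        unfolding c_def using k
        by (intro frac_le power_mono) (auto intro!: mult_left_mono)
      then have "ennreal (exp (- real ?n * ln (norm x)) / (1 + ln (norm x))\<^sup>2)
          \<le> (\<Sum>i\<in>{k}. ennreal (c i) * indicator (cball 0 (exp (real i + 1))) x)"
        using mem by (simp add: ennreal_leI)
      also have "\<dots> \<le> (\<Sum>i. ennreal (c i) * indicator (cball 0 (exp (real i + 1))) x)"
        by (intro sum_le_suminf) auto
      finally show ?thesis using True by simp
    qed simp
  qed
  also have "\<dots> = (\<Sum>k. \<integral>\<^sup>+x. ennreal (c k) * indicator (cball (0 :: 'a) (exp (real k + 1))) x \<partial>lborel)"
    by (intro nn_integral_suminf borel_measurable_times_ennreal borel_measurable_indicator) auto
  also have "\<dots> = (\<Sum>k. ennreal (V * exp (real ?n) * inverse (real (Suc k) ^ 2)))"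
  proof (rule arg_cong [where f = suminf], rule ext)
    fix k
    have "(\<integral>\<^sup>+x. ennreal (c k) * indicator (cball (0 :: 'a) (exp (real k + 1))) x \<partial>lborel)
        = ennreal (c k * (V * exp (real k + 1) ^ ?n))"
    proof -
      have "0 \<le> c k" by (simp add: c_def)
      then show ?thesis
        using V by (simp add: nn_integral_cmult_indicator emeasure_cball V_def flip: ennreal_mult)
    qed
    also have "c k * (V * exp (real k + 1) ^ ?n) = V * exp (real ?n) * inverse (real (Suc k) ^ 2)"
      by (simp add: c_def exp_of_nat_mult [symmetric] distrib_left exp_add exp_minus field_simps)
    finally show "(\<integral>\<^sup>+x. ennreal (c k) * indicator (cball (0 :: 'a) (exp (real k + 1))) x \<partial>lborel)
        = ennreal (V * exp (real ?n) * inverse (real (Suc k) ^ 2))" .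
  qed
  also have "\<dots> = ennreal (\<Sum>k. V * exp (real ?n) * inverse (real (Suc k) ^ 2))"
  proof (rule suminf_ennreal2)
    have "summable (\<lambda>k. inverse (real (Suc k) ^ 2))"
      using inverse_power_summable [of 2, where 'a = real] by (subst summable_Suc_iff) simp
    then show "summable (\<lambda>k. V * exp (real ?n) * inverse (real (Suc k) ^ 2))"
      by (rule summable_mult)
  qed (use V in auto)
  finally show ?thesis by (simp add: le_less_trans)
qed

lemma log_weight_integrable:
  "integrable (lebesgue_on (- cball 0 1))
     (\<lambda>x :: 'a::euclidean_space. exp (- real DIM('a) * ln (norm x)) / (1 + ln (norm x))\<^sup>2)"
    (is "integrable _ ?h")
proof -
  have eq: "- cball (0 :: 'a) 1 = {x. 1 < norm x}" by auto
  have \<Omega>: "{x :: 'a. 1 < norm x} \<inter> space lebesgue \<in> sets lebesgue"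
    by (auto simp flip: eq)
  have meas: "(\<lambda>x. indicator {x :: 'a. 1 < norm x} x *\<^sub>R ?h x) \<in> borel_measurable lborel"
    by measurable
  have "(\<integral>\<^sup>+x. ennreal (norm (indicator {x :: 'a. 1 < norm x} x *\<^sub>R ?h x)) \<partial>lborel) < \<infinity>"
    using log_weight_nn_integral_finite [where 'a = 'a]
    by (rule le_less_trans [rotated]) (auto intro!: nn_integral_mono simp: indicator_def)
  then have "integrable lborel (\<lambda>x. indicator {x :: 'a. 1 < norm x} x *\<^sub>R ?h x)"
    using meas by (intro integrableI_bounded) auto
  then show ?thesis
    unfolding eq integrable_restrict_space [OF \<Omega>] integrable_completion [OF meas] .
qed

section \<open>The test fields\<close>

text \<open>
  A bump supported in \<open>[1/k, k]\<close>. The parameter of each flat factor is proportional to the length on which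
  it acts, so that with \<open>k \<rightarrow> \<infinity>\<close> the left factor tends to \<open>1\<close> and the right one to \<open>exp (-1)\<close>; the factor
  \<open>exp 1\<close> compensates the latter.
\<close>
definition cutoff :: "real \<Rightarrow> real \<Rightarrow> real" where
  "cutoff k s = exp 1 * (flat (1 / k) 0 (s - 1 / k) * flat k 0 (k - s))"

definition cutoff_deriv :: "real \<Rightarrow> real \<Rightarrow> real" where
  "cutoff_deriv k s = exp 1 * (1 / k * flat (1 / k) 2 (s - 1 / k) * flat k 0 (k - s)
      - flat (1 / k) 0 (s - 1 / k) * (k * flat k 2 (k - s)))"

text \<open>The primitive of \<open>e\<^sup>-\<^sup>s\<^sup>/\<^sup>m\<close> that vanishes at \<open>0\<close>; it saturates at the value \<open>m\<close>.\<close>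
definition saturation :: "real \<Rightarrow> real \<Rightarrow> real" where
  "saturation m s = m * (1 - exp (- s / m))"

definition profile_deriv :: "real \<Rightarrow> real \<Rightarrow> real \<Rightarrow> real" where
  "profile_deriv m k s = cutoff_deriv k s * saturation m s + cutoff k s * exp (- s / m)"

lemma cutoff_has_derivative:
  assumes "0 < k"
  shows "(cutoff k has_real_derivative cutoff_deriv k s) (at s)"
proof -
  have "0 < 1 / k" using assms by simp
  then have 1: "((\<lambda>s. flat (1 / k) 0 (s - 1 / k)) has_real_derivative
      (1 / k * flat (1 / k) (0 + 2) (s - 1 / k) - real 0 * flat (1 / k) (0 + 1) (s - 1 / k)) * 1) (at s)"
    by (intro DERIV_chain2 [OF flat_has_derivative]) (auto intro!: derivative_eq_intros)
  have 2: "((\<lambda>s. flat k 0 (k - s)) has_real_derivative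
      (k * flat k (0 + 2) (k - s) - real 0 * flat k (0 + 1) (k - s)) * (- 1)) (at s)"
    using assms by (intro DERIV_chain2 [OF flat_has_derivative]) (auto intro!: derivative_eq_intros)
  show ?thesis
    unfolding cutoff_def [abs_def] cutoff_deriv_def
    by (rule DERIV_cong [OF DERIV_cmult [OF DERIV_mult [OF 1 2]]]) (simp add: algebra_simps numeral_2_eq_2)
qed

lemma profile_has_derivative:
  assumes "0 < k" "0 < m"
  shows "((\<lambda>s. cutoff k s * saturation m s) has_real_derivative profile_deriv m k s) (at s)"
proof -
  have "(saturation m has_real_derivative exp (- s / m)) (at s)"
    unfolding saturation_def [abs_def] using assms by (auto intro!: derivative_eq_intros)
  from DERIV_mult [OF cutoff_has_derivative [OF assms(1)] this] show ?thesis
    by (simp add: profile_deriv_def mult.commute)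
qed

lemma saturation_bounds:
  assumes "0 < m" "0 \<le> s"
  shows "0 \<le> saturation m s" "saturation m s \<le> m" "saturation m s \<le> s"
proof -
  have "1 + (- s / m) \<le> exp (- s / m)" by (rule exp_ge_add_one_self)
  then have "m * (1 - exp (- s / m)) \<le> m * (s / m)" using assms by (intro mult_left_mono) auto
  then show "saturation m s \<le> s" using assms by (simp add: saturation_def)
  show "0 \<le> saturation m s" "saturation m s \<le> m"
    using assms by (auto simp: saturation_def mult_le_cancel_left1)
qed

lemma profile_deriv_tendsto:
  assumes "0 < s" "0 < m"
  shows "((\<lambda>k. profile_deriv m k s) \<longlongrightarrow> exp (- s / m)) at_top"
proof (rule Lim_transform_eventually)
  let ?E = "\<lambda>k. exp 1 * (exp (- (1 / k) / (s - 1 / k)) * exp (- k / (k - s)))"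
  show "((\<lambda>k. ?E k * (1 / k / (s - 1 / k)\<^sup>2 - k / (k - s)\<^sup>2) * saturation m s + ?E k * exp (- s / m))
      \<longlongrightarrow> exp (- s / m)) at_top"
  proof -
    have D: "((\<lambda>k. 1 / k / (s - 1 / k)\<^sup>2 - k / (k - s)\<^sup>2) \<longlongrightarrow> 0) at_top"
      using assms by real_asymp
    have "((\<lambda>k. exp (- (1 / k) / (s - 1 / k)) * exp (- k / (k - s))) \<longlongrightarrow> exp (- 1)) at_top"
      using assms by real_asymp
    then have "((\<lambda>k. ?E k) \<longlongrightarrow> exp 1 * exp (- 1)) at_top" by (rule tendsto_mult_left)
    then have E: "((\<lambda>k. ?E k) \<longlongrightarrow> 1) at_top" by (simp flip: exp_add)
    from tendsto_add [OF tendsto_mult [OF tendsto_mult [OF E D] tendsto_const]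
        tendsto_mult [OF E tendsto_const]]
    show ?thesis by simp
  qed
  show "eventually (\<lambda>k. ?E k * (1 / k / (s - 1 / k)\<^sup>2 - k / (k - s)\<^sup>2) * saturation m s
      + ?E k * exp (- s / m) = profile_deriv m k s) at_top"
    using eventually_gt_at_top [of s] eventually_gt_at_top [of "1 / s"]
  proof eventually_elim
    case (elim k)
    then have "0 < k" using assms by linarith
    then have "1 / k < s" using elim assms by (simp add: field_simps)
    then show ?case
      using elim
      by (simp add: profile_deriv_def cutoff_def cutoff_deriv_def flat_def power_inverse
          divide_inverse algebra_simps)
  qed
qed

text \<open>
  The estimate that makes logarithmic cutoffs work. With \<open>Y = (1/k) / (s - 1/k)\<close> and \<open>Z = k / (k - s)\<close> the
  two flat factors are \<open>e\<^sup>-\<^sup>Y\<close> and \<open>e\<^sup>-\<^sup>Z\<close>. Where the left factor varies, its derivative \<open>e\<^sup>-\<^sup>Y Y\<^sup>2 k\<close> is large, but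
  the saturation is at most \<open>s = (1 + 1/Y) / k\<close> there; where the right one varies, its derivative
  \<open>e\<^sup>-\<^sup>Z Z\<^sup>2 / k\<close> is \<open>O(1/k)\<close> and \<open>1 + s \<le> 2 k\<close>. The remaining term decays exponentially.
\<close>
lemma profile_deriv_bound:
  assumes "1 \<le> m" "1 \<le> k" "0 \<le> s"
  shows "\<bar>profile_deriv m k s\<bar> \<le> (4 + 4 * exp 1 * m + m) / (1 + s)"
proof (cases "1 / k < s \<and> s < k")
  case False
  then have "cutoff k s = 0" "cutoff_deriv k s = 0"
    by (auto simp: cutoff_def cutoff_deriv_def flat_def)
  then show ?thesis using assms by (simp add: profile_deriv_def)
next
  case True
  define Y where "Y = (1 / k) / (s - 1 / k)"
  define Z where "Z = k / (k - s)"
  define M where "M = saturation m s"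
  have k: "0 < k" "1 / k \<le> 1" using assms by auto
  have Y: "0 < Y" and Z: "1 \<le> Z"
    using True assms k by (auto simp: Y_def Z_def)
  have M: "0 \<le> M" "M \<le> m" "M \<le> s"
    using saturation_bounds [of m s] assms by (auto simp: M_def)
  have s_Y: "s = 1 / k * (1 + 1 / Y)"
    using True k by (simp add: Y_def field_simps)
  have eZ: "exp 1 * exp (- Z) \<le> 1" using Z by (simp flip: exp_add)
  have f1: "flat (1 / k) i (s - 1 / k) = exp (- Y) * inverse (s - 1 / k) ^ i" for i
    using True by (simp add: flat_def Y_def)
  have f2: "flat k i (k - s) = exp (- Z) * inverse (k - s) ^ i" for i
    using True by (simp add: flat_def Z_def)
  have Y2: "1 / k * (inverse (s - 1 / k))\<^sup>2 = Y\<^sup>2 * k" and Z2: "k * (inverse (k - s))\<^sup>2 = Z\<^sup>2 / k"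
    using k by (simp_all add: Y_def Z_def power2_eq_square divide_inverse)
  have "profile_deriv m k s =
      exp 1 * (exp (- Y) * exp (- Z) * (1 / k * (inverse (s - 1 / k))\<^sup>2)
        - exp (- Y) * exp (- Z) * (k * (inverse (k - s))\<^sup>2)) * M
      + exp 1 * (exp (- Y) * exp (- Z)) * exp (- s / m)"
    unfolding profile_deriv_def cutoff_def cutoff_deriv_def M_def [symmetric] f1 f2
    by (simp add: algebra_simps)
  then have split: "profile_deriv m k s =
      (exp (- Y) * (Y\<^sup>2 * k * M)) * (exp 1 * exp (- Z))
      - exp 1 * exp (- Y) * (exp (- Z) * Z\<^sup>2 * (M / k))
      + exp (- Y) * (exp 1 * exp (- Z)) * exp (- s / m)"
    unfolding Y2 Z2 by (simp add: algebra_simps)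
  have t1: "(exp (- Y) * (Y\<^sup>2 * k * M)) * (exp 1 * exp (- Z)) * (1 + s) \<le> 4"
  proof -
    have "(exp (- Y) * (Y\<^sup>2 * k * M)) * (exp 1 * exp (- Z)) * (1 + s)
        \<le> (exp (- Y) * (Y\<^sup>2 * k * s)) * 1 * (2 + 1 / Y)"
    proof (intro mult_mono eZ mult_left_mono M)
      have "1 / k * (1 + 1 / Y) \<le> 1 * (1 + 1 / Y)"
        using k Y by (intro mult_right_mono) auto
      then show "1 + s \<le> 2 + 1 / Y" using s_Y by simp
    qed (use M Y k assms in auto)
    also have "k * s = 1 + 1 / Y" using s_Y k by simp
    then have "(exp (- Y) * (Y\<^sup>2 * k * s)) * 1 * (2 + 1 / Y)
        = exp (- Y) * (Y\<^sup>2 * (1 + 1 / Y) * (2 + 1 / Y))" by (simp add: mult.assoc)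
    also have "Y\<^sup>2 * (1 + 1 / Y) * (2 + 1 / Y) = (Y + 1) * (2 * Y + 1)"
      using Y by (simp add: field_simps power2_eq_square)
    also have "\<dots> \<le> 4 * (1 + Y + Y\<^sup>2 / 2)"
      using Y by (simp add: algebra_simps power2_eq_square)
    also have "\<dots> \<le> 4 * exp Y"
      using exp_lower_Taylor_quadratic [of Y] Y by simp
    finally show ?thesis by (simp add: exp_minus field_simps)
  qed
  have t2: "exp 1 * exp (- Y) * (exp (- Z) * Z\<^sup>2 * (M / k)) * (1 + s) \<le> 4 * exp 1 * m"
  proof -
    have "Z\<^sup>2 \<le> 2 * exp Z" using power_le_fact_exp [of Z 2] Z by simp
    then have "exp (- Z) * Z\<^sup>2 \<le> 2" by (simp add: exp_minus field_simps)
    moreover have "1 + s \<le> 2 * k" using True assms by linarith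
    ultimately have "exp 1 * exp (- Y) * (exp (- Z) * Z\<^sup>2 * (M / k)) * (1 + s)
        \<le> exp 1 * 1 * (2 * (m / k)) * (2 * k)"
      using M Y k assms by (intro mult_mono divide_right_mono) auto
    then show ?thesis using k by simp
  qed
  have t3: "exp (- Y) * (exp 1 * exp (- Z)) * exp (- s / m) * (1 + s) \<le> m"
  proof -
    have "1 + s \<le> m * (1 + s / m)" using assms by (simp add: field_simps)
    also have "\<dots> \<le> m * exp (s / m)" using assms exp_ge_add_one_self [of "s / m"] by simp
    finally have "exp (- s / m) * (1 + s) \<le> m" by (simp add: exp_minus field_simps)
    moreover have "exp (- Y) * (exp 1 * exp (- Z)) * (exp (- s / m) * (1 + s))
        \<le> 1 * 1 * (exp (- s / m) * (1 + s))"
      using Y eZ assms by (intro mult_mono) auto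
    ultimately have "exp (- Y) * (exp 1 * exp (- Z)) * (exp (- s / m) * (1 + s)) \<le> m" by linarith
    then show ?thesis by (simp only: mult.assoc)
  qed
  have abs_split: "\<bar>A - B + C\<bar> \<le> A + B + C" if "0 \<le> A" "0 \<le> B" "0 \<le> C" for A B C :: real
    using that by linarith
  have "\<bar>profile_deriv m k s\<bar> \<le> (exp (- Y) * (Y\<^sup>2 * k * M)) * (exp 1 * exp (- Z))
      + exp 1 * exp (- Y) * (exp (- Z) * Z\<^sup>2 * (M / k))
      + exp (- Y) * (exp 1 * exp (- Z)) * exp (- s / m)"
    unfolding split by (rule abs_split) (use M k in auto)
  then have "\<bar>profile_deriv m k s\<bar> * (1 + s) \<le> ((exp (- Y) * (Y\<^sup>2 * k * M)) * (exp 1 * exp (- Z))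
      + exp 1 * exp (- Y) * (exp (- Z) * Z\<^sup>2 * (M / k))
      + exp (- Y) * (exp 1 * exp (- Z)) * exp (- s / m)) * (1 + s)"
    using assms by (intro mult_right_mono) auto
  also have "\<dots> \<le> 4 + 4 * exp 1 * m + m"
    using t1 t2 t3 unfolding distrib_right by linarith
  finally show ?thesis using assms by (simp add: pos_le_divide_eq)
qed

lemma profile_bump_span:
  "bump_span (1 / k) k (1 / k) k (\<lambda>s. exp (- n * s) * (cutoff k s * saturation m s))"
proof -
  let ?B = "\<lambda>c s. flat (1 / k) 0 (s - 1 / k) * flat k 0 (k - s) * exp (c * s)"
  \<comment> \<open>The two summands of the saturation, \<open>m\<close> and \<open>- m e\<^sup>-\<^sup>s\<^sup>/\<^sup>m\<close>, shift the exponent to \<open>- n\<close> and \<open>- n - 1/m\<close>.\<close>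
  have "bump_span (1 / k) k (1 / k) k (\<lambda>s. (exp 1 * m) * ?B (- n) s + (- exp 1 * m) * ?B (- n - 1 / m) s)"
    by (intro bump_span.intros)
  moreover have "(\<lambda>s. (exp 1 * m) * ?B (- n) s + (- exp 1 * m) * ?B (- n - 1 / m) s) =
      (\<lambda>s. exp (- n * s) * (cutoff k s * saturation m s))"
  proof
    fix s
    have "exp ((- n - 1 / m) * s) = exp (- n * s) * exp (- s / m)"
      by (simp add: algebra_simps flip: exp_add)
    then show "(exp 1 * m) * ?B (- n) s + (- exp 1 * m) * ?B (- n - 1 / m) s =
        exp (- n * s) * (cutoff k s * saturation m s)"
      by (simp only: cutoff_def saturation_def) (simp add: algebra_simps)
  qed
  ultimately show ?thesis by simp
qed

definition test_field :: "real \<Rightarrow> real \<Rightarrow> real ^ 'n::{finite,linorder} \<Rightarrow> 'n clifford" where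
  "test_field m k x = (exp (- real CARD('n) * ln (norm x)) * (cutoff k (ln (norm x)) *
      saturation m (ln (norm x)))) *\<^sub>R clif_vec x"

lemma test_field_test_function:
  assumes "0 < k"
  shows "test_field m k \<in> test_functions (- cball 0 1)"
  unfolding test_field_def [abs_def]
  using radial_vector_field_test_function [OF profile_bump_span] assms by auto

lemma dirac_test_field:
  fixes x :: "real ^ 'n::{finite,linorder}"
  assumes "0 < k" "0 < m"
  shows "dirac (test_field m k) x =
      clif_of_real (- (exp (- real CARD('n) * ln (norm x)) * profile_deriv m k (ln (norm x))))"
proof -
  let ?n = "real CARD('n)" and ?s = "ln (norm x)"
  have "((\<lambda>s. exp (- ?n * s)) has_real_derivative - ?n * exp (- ?n * ?s)) (at ?s)"
    by (auto intro!: derivative_eq_intros)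
  note d = DERIV_mult [OF this profile_has_derivative [OF assms]]
  have "0 < 1 / k" using assms by simp
  from dirac_radial_vector_field [OF profile_bump_span this this assms(1) d]
  show ?thesis
    unfolding test_field_def [abs_def] by (simp add: algebra_simps)
qed

section \<open>Minimality by orthogonality\<close>
lemma borel_measurable_lebesgue_on:
  "f \<in> borel_measurable borel \<Longrightarrow> f \<in> borel_measurable (lebesgue_on \<Omega>)"
  by (intro measurable_restrict_space1 measurable_completion) simp

lemma L2_weighted_product_integrable:
  assumes \<phi>: "\<phi> \<in> borel_measurable (lebesgue_on \<Omega>)"
    and u: "u \<in> L2_weighted \<phi> \<Omega>" and w: "w \<in> L2_weighted \<phi> \<Omega>"
  shows "integrable (lebesgue_on \<Omega>) (\<lambda>x. (w x \<bullet> u x) * exp (- \<phi> x))"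
proof (rule Bochner_Integration.integrable_bound)
  show "integrable (lebesgue_on \<Omega>) (\<lambda>x. (norm (w x))\<^sup>2 * exp (- \<phi> x) + (norm (u x))\<^sup>2 * exp (- \<phi> x))"
    using u w by (simp add: L2_weighted_def)
  have [measurable]: "u \<in> borel_measurable (lebesgue_on \<Omega>)" "w \<in> borel_measurable (lebesgue_on \<Omega>)"
    using u w by (auto simp: L2_weighted_def)
  show "(\<lambda>x. (w x \<bullet> u x) * exp (- \<phi> x)) \<in> borel_measurable (lebesgue_on \<Omega>)"
    using \<phi> by measurable
  have "\<bar>w x \<bullet> u x\<bar> \<le> (norm (w x))\<^sup>2 + (norm (u x))\<^sup>2" for x
  proof -
    have "\<bar>w x \<bullet> u x\<bar> \<le> norm (w x) * norm (u x)" by (rule Cauchy_Schwarz_ineq2)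
    also have "\<dots> \<le> 2 * norm (w x) * norm (u x)" by simp
    also have "\<dots> \<le> (norm (w x))\<^sup>2 + (norm (u x))\<^sup>2" by (rule sum_squares_bound)
    finally show ?thesis .
  qed
  then show "AE x in lebesgue_on \<Omega>. norm ((w x \<bullet> u x) * exp (- \<phi> x))
      \<le> norm ((norm (w x))\<^sup>2 * exp (- \<phi> x) + (norm (u x))\<^sup>2 * exp (- \<phi> x))"
    by (intro AE_I2) (simp add: abs_mult flip: distrib_right)
qed

lemma norm_weighted_square:
  "(norm_weighted \<phi> \<Omega> u)\<^sup>2 = (LINT x|lebesgue_on \<Omega>. (norm (u x))\<^sup>2 * exp (- \<phi> x))"
  by (simp add: norm_weighted_def)

text \<open>Pythagoras: the hypothesis says that \<open>w - u\<close> is orthogonal to \<open>u\<close>, whence \<open>|w - u|\<^sup>2 = |w|\<^sup>2 - |u|\<^sup>2\<close>.\<close>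
lemma norm_weighted_minimal_if_orthogonal:
  assumes \<phi>: "\<phi> \<in> borel_measurable (lebesgue_on \<Omega>)"
    and u: "u \<in> L2_weighted \<phi> \<Omega>" and w: "w \<in> L2_weighted \<phi> \<Omega>"
    and orth: "(LINT x|lebesgue_on \<Omega>. (w x \<bullet> u x) * exp (- \<phi> x))
      = (LINT x|lebesgue_on \<Omega>. (u x \<bullet> u x) * exp (- \<phi> x))"
  shows "norm_weighted \<phi> \<Omega> u \<le> norm_weighted \<phi> \<Omega> w"
    and "norm_weighted \<phi> \<Omega> w = norm_weighted \<phi> \<Omega> u \<Longrightarrow> AE x in lebesgue_on \<Omega>. w x = u x"
proof -
  let ?M = "lebesgue_on \<Omega>"
  let ?d = "\<lambda>x. (norm (w x - u x))\<^sup>2 * exp (- \<phi> x)"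
  have ints: "integrable ?M (\<lambda>x. (norm (u x))\<^sup>2 * exp (- \<phi> x))"
    "integrable ?M (\<lambda>x. (norm (w x))\<^sup>2 * exp (- \<phi> x))"
    "integrable ?M (\<lambda>x. (w x \<bullet> u x) * exp (- \<phi> x))"
    using u w L2_weighted_product_integrable [OF \<phi> u w] by (auto simp: L2_weighted_def)
  have d: "?d = (\<lambda>x. (norm (w x))\<^sup>2 * exp (- \<phi> x) + (norm (u x))\<^sup>2 * exp (- \<phi> x)
      - 2 * ((w x \<bullet> u x) * exp (- \<phi> x)))"
    by (auto simp: fun_eq_iff power2_norm_eq_inner inner_diff inner_commute algebra_simps)
  have int_d: "integrable ?M ?d" unfolding d using ints by simp
  have "integral\<^sup>L ?M ?d = (norm_weighted \<phi> \<Omega> w)\<^sup>2 + (norm_weighted \<phi> \<Omega> u)\<^sup>2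
      - 2 * (LINT x|?M. (w x \<bullet> u x) * exp (- \<phi> x))"
    unfolding d norm_weighted_square using ints by simp
  also have "\<dots> = (norm_weighted \<phi> \<Omega> w)\<^sup>2 - (norm_weighted \<phi> \<Omega> u)\<^sup>2"
    unfolding orth by (simp add: norm_weighted_square power2_norm_eq_inner)
  finally have pythagoras: "integral\<^sup>L ?M ?d = (norm_weighted \<phi> \<Omega> w)\<^sup>2 - (norm_weighted \<phi> \<Omega> u)\<^sup>2" .
  have "0 \<le> integral\<^sup>L ?M ?d" by simp
  then have "(norm_weighted \<phi> \<Omega> u)\<^sup>2 \<le> (norm_weighted \<phi> \<Omega> w)\<^sup>2" using pythagoras by linarith
  then show "norm_weighted \<phi> \<Omega> u \<le> norm_weighted \<phi> \<Omega> w"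
    by (rule power2_le_imp_le) (simp add: norm_weighted_def)
  assume "norm_weighted \<phi> \<Omega> w = norm_weighted \<phi> \<Omega> u"
  then have "integral\<^sup>L ?M ?d = 0" using pythagoras by simp
  then have "AE x in ?M. ?d x = 0"
    using integral_nonneg_eq_0_iff_AE [OF int_d] by simp
  then show "AE x in ?M. w x = u x" by simp
qed

section \<open>Powers and the logarithm of the norm\<close>
lemma norm_powr_step:
  assumes "x \<noteq> 0"
  shows "norm x * norm x powr (c - 2) = norm x powr (c - 1)"
    and "norm x * norm x powr (c - 1) = norm x powr c"
  using assms powr_mult_base [of "norm x" "c - 2"] powr_mult_base [of "norm x" "c - 1"] by simp_all

lemma has_derivative_norm_powr:
  fixes x :: "'a::real_inner"
  assumes "x \<noteq> 0"
  shows "((\<lambda>x. norm x powr c) has_derivative (\<lambda>h. c * norm x powr (c - 2) * (x \<bullet> h))) (at x)"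
proof -
  have pos: "0 < norm x" using assms by simp
  have "(\<lambda>h. c * norm x powr (c - 1) * (h \<bullet> sgn x)) = (\<lambda>h. c * norm x powr (c - 2) * (x \<bullet> h))"
    using pos norm_powr_step(1) [OF assms, of c, symmetric]
    by (simp add: sgn_div_norm inner_commute fun_eq_iff)
  with has_derivative_compose [OF has_derivative_norm [OF assms]
      has_real_derivative_powr [OF pos, of c, unfolded has_field_derivative_def]]
  show ?thesis by simp
qed

lemma partial_deriv_norm_powr:
  assumes "x \<noteq> 0"
  shows "(\<lambda>x. clif_of_real (norm x powr c)) differentiable (at x)"
    and "partial_deriv j (\<lambda>x. clif_of_real (norm x powr c)) x
      = clif_of_real (c * norm x powr (c - 2) * x $ j)"
proof -
  note d = bounded_linear.has_derivative [OF bounded_linear_clif_of_real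
      has_derivative_norm_powr [OF assms, of c]]
  show "(\<lambda>x. clif_of_real (norm x powr c)) differentiable (at x)"
    using d unfolding differentiable_def by blast
  show "partial_deriv j (\<lambda>x. clif_of_real (norm x powr c)) x
      = clif_of_real (c * norm x powr (c - 2) * x $ j)"
    using partial_deriv_eq [OF d, of j] by (simp add: inner_axis)
qed

lemma dirac_norm_powr:
  assumes "x \<noteq> 0"
  shows "dirac (\<lambda>x. clif_of_real (norm x powr c)) x = (c * norm x powr (c - 2)) *\<^sub>R clif_vec x"
  by (simp add: dirac_def partial_deriv_norm_powr [OF assms] clif_of_real_mult clif_vec_def
      scaleR_sum_right)

lemma laplacian_ln_norm:
  fixes x :: "real ^ 'n::finite"
  assumes "x \<noteq> 0"
  shows "laplacian (\<lambda>x. a * ln (norm x)) x = a * (real CARD('n) - 2) / (norm x)\<^sup>2"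
proof -
  have 1: "partial_deriv j (\<lambda>x. a * ln (norm x)) y = a * y $ j / (y \<bullet> y)" if "y \<noteq> 0"
    for j and y :: "real ^ 'n"
  proof -
    have "exp (- 2 * ln (norm y)) = 1 / (y \<bullet> y)"
      using that by (simp add: exp_minus exp_double divide_inverse power2_norm_eq_inner)
    then show ?thesis
      using partial_deriv_eq [OF has_derivative_mult_right [OF has_derivative_ln_norm [OF that]], of j a]
      by (simp add: inner_axis)
  qed
  have 2: "partial_deriv j (partial_deriv j (\<lambda>x. a * ln (norm x))) x
      = a * (x \<bullet> x - 2 * (x $ j)\<^sup>2) / (x \<bullet> x)\<^sup>2" for j
  proof -
    have "((\<lambda>y. a * y $ j / (y \<bullet> y)) has_derivative
        (\<lambda>h. (a * h $ j * (x \<bullet> x) - a * x $ j * (x \<bullet> h + h \<bullet> x)) / ((x \<bullet> x) * (x \<bullet> x)))) (at x)"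
      using assms
      by (intro has_derivative_divide' has_derivative_mult_right has_derivative_inner has_derivative_ident
          bounded_linear_imp_has_derivative [OF bounded_linear_vec_nth]) auto
    then have "(partial_deriv j (\<lambda>x. a * ln (norm x)) has_derivative
        (\<lambda>h. (a * h $ j * (x \<bullet> x) - a * x $ j * (x \<bullet> h + h \<bullet> x)) / ((x \<bullet> x) * (x \<bullet> x)))) (at x)"
      by (rule has_derivative_transform_within_open [where s = "- {0}"]) (use assms 1 in auto)
    from partial_deriv_eq [OF this, of j] show ?thesis
      by (simp add: inner_axis inner_commute [of "axis _ _"] power2_eq_square algebra_simps)
  qed
  have "(\<Sum>j\<in>UNIV. (x $ j)\<^sup>2) = x \<bullet> x"
    by (simp add: inner_vec_def power2_eq_square)
  then have "(\<Sum>j\<in>UNIV. x \<bullet> x - 2 * (x $ j)\<^sup>2) = (real CARD('n) - 2) * (x \<bullet> x)"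
    by (simp add: sum_subtractf left_diff_distrib flip: sum_distrib_left)
  then have "laplacian (\<lambda>x. a * ln (norm x)) x = a * ((real CARD('n) - 2) * (x \<bullet> x)) / (x \<bullet> x)\<^sup>2"
    unfolding laplacian_def 2 by (simp flip: sum_divide_distrib sum_distrib_left)
  then show ?thesis
    using assms by (simp add: power2_eq_square flip: power2_norm_eq_inner)
qed

section \<open>The limit of the test fields and the theorem\<close>

text \<open>
  With \<open>W = e\<^sup>-\<^sup>\<phi>\<close>, the integrand is at most \<open>|w| W K / (1 + s)\<close>, which by the arithmetic-geometric mean
  inequality is dominated by \<open>|w|\<^sup>2 W + K\<^sup>2 W / (1 + s)\<^sup>2\<close>. Passing to the limit for each \<open>w\<close> separately,
  rather than for a difference of two solutions, keeps the integrals of the weak equation unsplit.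
\<close>
lemma test_field_integral_tendsto:
  fixes w :: "real ^ 'n::{finite,linorder} \<Rightarrow> 'n clifford"
  assumes w: "w \<in> L2_weighted (\<lambda>x. real CARD('n) * ln (norm x)) (- cball 0 1)"
    and m: "1 \<le> m"
  shows "(\<lambda>k. LINT x|lebesgue_on (- cball 0 1). w x \<bullet> dirac (test_field m (real (Suc k))) x)
    \<longlonglongrightarrow> - (LINT x|lebesgue_on (- cball 0 1).
      (w x \<bullet> clif_of_real (norm x powr (- 1 / m))) * exp (- (real CARD('n) * ln (norm x))))"
proof -
  let ?M = "lebesgue_on (- cball (0 :: real ^ 'n::{finite,linorder}) 1)"
  let ?s = "\<lambda>x :: real ^ 'n::{finite,linorder}. ln (norm x)"
  define W where "W = (\<lambda>x :: real ^ 'n::{finite,linorder}. exp (- (real CARD('n) * ln (norm x))))"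
  define K where "K = 4 + 4 * exp 1 * m + m"
  have Wpos: "0 < W x" for x by (simp add: W_def)
  have dir: "dirac (test_field m (real (Suc k))) x
      = clif_of_real (- (W x * profile_deriv m (real (Suc k)) (?s x)))" for k and x :: "real ^ 'n::{finite,linorder}"
    using dirac_test_field [of "real (Suc k)" m x] m by (simp add: W_def)
  have [measurable]: "w \<in> borel_measurable ?M" using w by (simp add: L2_weighted_def)
  have "(\<lambda>k. LINT x|?M. w x \<bullet> dirac (test_field m (real (Suc k))) x)
      \<longlonglongrightarrow> (LINT x|?M. - ((w x \<bullet> clif_of_real (norm x powr (- 1 / m))) * W x))"
  proof (rule integral_dominated_convergence
      [where w = "\<lambda>x. (norm (w x))\<^sup>2 * W x + K\<^sup>2 * (W x / (1 + ?s x)\<^sup>2)"])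
    have "(\<lambda>x :: real ^ 'n::{finite,linorder}. clif_of_real (norm x powr (- 1 / m)) :: 'n clifford) \<in> borel_measurable borel"
      unfolding clif_of_real_def by measurable
    moreover have "W \<in> borel_measurable borel" unfolding W_def by measurable
    ultimately have [measurable]:
      "(\<lambda>x :: real ^ 'n::{finite,linorder}. clif_of_real (norm x powr (- 1 / m)) :: 'n clifford) \<in> borel_measurable ?M"
      "W \<in> borel_measurable ?M"
      by (simp_all only: borel_measurable_lebesgue_on)
    show "(\<lambda>x. - ((w x \<bullet> clif_of_real (norm x powr (- 1 / m))) * W x)) \<in> borel_measurable ?M"
      by measurable
    show "(\<lambda>x. w x \<bullet> dirac (test_field m (real (Suc k))) x) \<in> borel_measurable ?M" for k
    proof -
      have "test_field m (real (Suc k)) \<in> (test_functions (- cball 0 1) :: (real ^ 'n::{finite,linorder} \<Rightarrow> 'n clifford) set)"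
        by (rule test_field_test_function) simp
      then have "continuous_on UNIV (dirac (test_field m (real (Suc k)) :: real ^ 'n::{finite,linorder} \<Rightarrow> 'n clifford))"
        by (intro continuous_on_dirac test_functionD)
      then have [measurable]: "dirac (test_field m (real (Suc k))) \<in> borel_measurable ?M"
        by (intro borel_measurable_lebesgue_on borel_measurable_continuous_onI)
      show ?thesis by measurable
    qed
    show "integrable ?M (\<lambda>x. (norm (w x))\<^sup>2 * W x + K\<^sup>2 * (W x / (1 + ?s x)\<^sup>2))"
      using w log_weight_integrable [where 'a = "real ^ 'n::{finite,linorder}"]
      by (intro Bochner_Integration.integrable_add integrable_mult_right)
        (simp_all add: L2_weighted_def W_def)
    show "AE x in ?M. (\<lambda>k. w x \<bullet> dirac (test_field m (real (Suc k))) x)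
        \<longlonglongrightarrow> - ((w x \<bullet> clif_of_real (norm x powr (- 1 / m))) * W x)"
    proof (intro AE_I2)
      fix x assume "x \<in> space ?M"
      then have x: "1 < norm x" by simp
      have "0 < ?s x" using x by (rule ln_gt_zero)
      then have "(\<lambda>k. profile_deriv m (real (Suc k)) (?s x)) \<longlonglongrightarrow> exp (- ?s x / m)"
        using m by (intro filterlim_compose [OF profile_deriv_tendsto]
            filterlim_compose [OF filterlim_real_sequentially filterlim_Suc]) auto
      moreover have "exp (- ?s x / m) = norm x powr (- 1 / m)"
        using x by (auto simp: powr_def)
      ultimately have "(\<lambda>k. - ((w x \<bullet> clif_basis {}) * (W x * profile_deriv m (real (Suc k)) (?s x))))
          \<longlonglongrightarrow> - ((w x \<bullet> clif_basis {}) * (W x * norm x powr (- 1 / m)))"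
        by (intro tendsto_minus tendsto_mult_left) simp
      then show "(\<lambda>k. w x \<bullet> dirac (test_field m (real (Suc k))) x)
        \<longlonglongrightarrow> - ((w x \<bullet> clif_of_real (norm x powr (- 1 / m))) * W x)"
        unfolding dir by (simp add: clif_of_real_def mult_ac)
    qed
    show "AE x in ?M. norm (w x \<bullet> dirac (test_field m (real (Suc k))) x)
        \<le> (norm (w x))\<^sup>2 * W x + K\<^sup>2 * (W x / (1 + ?s x)\<^sup>2)" for k
    proof (intro AE_I2)
      fix x assume "x \<in> space ?M"
      then have x: "1 < norm x" by simp
      have s: "0 < ?s x" using x by (rule ln_gt_zero)
      define B where "B = K / (1 + ?s x)"
      have K: "0 \<le> K" using m by (simp add: K_def)
      have B: "0 \<le> B" using s K by (simp add: B_def)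
      have P: "\<bar>profile_deriv m (real (Suc k)) (?s x)\<bar> \<le> B"
        using profile_deriv_bound [of m "real (Suc k)" "?s x"] m s by (simp add: B_def K_def)
      have "norm (w x \<bullet> dirac (test_field m (real (Suc k))) x)
          \<le> norm (w x) * norm (dirac (test_field m (real (Suc k))) x)"
        unfolding real_norm_def by (rule Cauchy_Schwarz_ineq2)
      also have "\<dots> = norm (w x) * (W x * \<bar>profile_deriv m (real (Suc k)) (?s x)\<bar>)"
        unfolding dir norm_clif_of_real using Wpos [of x] by (simp add: abs_mult)
      also have "\<dots> \<le> norm (w x) * (W x * B)"
        using P Wpos [of x] by (intro mult_left_mono) auto
      also have "\<dots> \<le> (2 * norm (w x) * B) * W x"
        using B Wpos [of x] by (simp add: mult_ac)
      also have "\<dots> \<le> ((norm (w x))\<^sup>2 + B\<^sup>2) * W x"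
        using Wpos [of x] by (intro mult_right_mono sum_squares_bound) auto
      also have "\<dots> = (norm (w x))\<^sup>2 * W x + K\<^sup>2 * (W x / (1 + ?s x)\<^sup>2)"
        by (simp add: B_def power_divide distrib_right)
      finally show "norm (w x \<bullet> dirac (test_field m (real (Suc k))) x)
        \<le> (norm (w x))\<^sup>2 * W x + K\<^sup>2 * (W x / (1 + ?s x)\<^sup>2)" .
    qed
  qed
  then show ?thesis by (simp add: W_def)
qed

text \<open>
  The inequality \<open>1 + s \<le> m e\<^sup>s\<^sup>/\<^sup>m\<close> bounds \<open>|x|\<^sup>-\<^sup>1\<^sup>/\<^sup>m = e\<^sup>-\<^sup>s\<^sup>/\<^sup>m\<close> by \<open>m / (1 + s)\<close>, so that the integrable
  logarithmic weight serves as majorant.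
\<close>
lemma norm_powr_L2_weighted:
  assumes "1 \<le> m"
  shows "(\<lambda>x. clif_of_real (norm x powr (- 1 / m)) :: 'n clifford) \<in>
    L2_weighted (\<lambda>x :: real ^ 'n::{finite,linorder}. real CARD('n) * ln (norm x)) (- cball 0 1)"
    (is "?u \<in> _")
proof -
  let ?M = "lebesgue_on (- cball (0 :: real ^ 'n::{finite,linorder}) 1)"
  let ?W = "\<lambda>x :: real ^ 'n::{finite,linorder}. exp (- (real CARD('n) * ln (norm x)))"
  have u_borel: "?u \<in> borel_measurable borel" unfolding clif_of_real_def by measurable
  have "integrable ?M (\<lambda>x. (norm (?u x))\<^sup>2 * ?W x)"
  proof (rule Bochner_Integration.integrable_bound)
    show "integrable ?M (\<lambda>x. m\<^sup>2 * (?W x / (1 + ln (norm x))\<^sup>2))"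
      using log_weight_integrable [where 'a = "real ^ 'n::{finite,linorder}"] by (intro integrable_mult_right) simp
    have "(\<lambda>x. (norm (?u x))\<^sup>2 * ?W x) \<in> borel_measurable borel"
      using u_borel by measurable
    then show "(\<lambda>x. (norm (?u x))\<^sup>2 * ?W x) \<in> borel_measurable ?M"
      by (rule borel_measurable_lebesgue_on)
    show "AE x in ?M. norm ((norm (?u x))\<^sup>2 * ?W x) \<le> norm (m\<^sup>2 * (?W x / (1 + ln (norm x))\<^sup>2))"
    proof (intro AE_I2)
      fix x assume "x \<in> space ?M"
      then have x: "1 < norm x" by simp
      have s: "0 < ln (norm x)" using x by (rule ln_gt_zero)
      have "1 + ln (norm x) \<le> m * (1 + ln (norm x) / m)" using assms by (simp add: field_simps)
      also have "\<dots> \<le> m * exp (ln (norm x) / m)"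
        using assms exp_ge_add_one_self [of "ln (norm x) / m"] by simp
      also have "\<dots> = m / norm (?u x)"
        using x by (auto simp: norm_clif_of_real powr_def exp_minus divide_inverse)
      finally have "1 + ln (norm x) \<le> m / norm (?u x)" .
      moreover have "0 < norm (?u x)" using x by (auto simp: norm_clif_of_real)
      ultimately have "(1 + ln (norm x)) * norm (?u x) \<le> m" by (simp only: pos_le_divide_eq)
      moreover have "0 < 1 + ln (norm x)" using s by simp
      ultimately have "norm (?u x) \<le> m / (1 + ln (norm x))"
        by (simp only: pos_le_divide_eq mult.commute [of "norm (?u x)"])
      then have "(norm (?u x))\<^sup>2 \<le> (m / (1 + ln (norm x)))\<^sup>2" by (rule power_mono) simp
      from mult_right_mono [OF this, of "?W x"]
      show "norm ((norm (?u x))\<^sup>2 * ?W x) \<le> norm (m\<^sup>2 * (?W x / (1 + ln (norm x))\<^sup>2))"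
        by (simp add: abs_mult power_divide)
    qed
  qed
  then show ?thesis
    using borel_measurable_lebesgue_on [OF u_borel] by (simp add: L2_weighted_def)
qed

theorem theorem1p2:
  fixes \<Omega> :: "(real ^ 'n::{finite,linorder}) set"
    and \<phi> :: "real ^ 'n::{finite,linorder} \<Rightarrow> real"
    and u f :: "nat \<Rightarrow> real ^ 'n::{finite,linorder} \<Rightarrow> 'n clifford"
  assumes "CARD('n) \<ge> 3"
    and "\<Omega> = - closure (ball 0 1)"
    and "\<phi> = (\<lambda>x. real CARD('n) * ln (norm x))"
    and "u = (\<lambda>m x. clif_of_real (norm x powr (- 1 / real m)))"
    and "f = (\<lambda>m x. (- (1 / real m) * norm x powr (- 1 / real m - 2)) *\<^sub>R clif_vec x)"
  shows "(\<forall>m\<ge>1.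
           (\<forall>x\<in>\<Omega>. u m differentiable (at x) \<and> dirac (u m) x = f m x) \<and>
           weak_dirac_solution \<Omega> (f m) (u m) \<and>
           minimal_dirac_solution \<phi> \<Omega> (f m) (u m)) \<and>
         filterlim (\<lambda>m. (norm_weighted \<phi> \<Omega> (u m))\<^sup>2 /
             (LINT x|lebesgue_on \<Omega>. (norm (f m x))\<^sup>2 / laplacian \<phi> x * exp (- \<phi> x)))
           at_top sequentially \<and>
         \<not> (\<exists>C::real. \<forall>g \<in> L2_weighted \<phi> \<Omega>.
             integrable (lebesgue_on \<Omega>) (\<lambda>x. (norm (g x))\<^sup>2 / laplacian \<phi> x * exp (- \<phi> x)) \<longrightarrow>
             (\<exists>w \<in> L2_weighted \<phi> \<Omega>. weak_dirac_solution \<Omega> g w \<and>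
               (norm_weighted \<phi> \<Omega> w)\<^sup>2 \<le>
                 C * (LINT x|lebesgue_on \<Omega>. (norm (g x))\<^sup>2 / laplacian \<phi> x * exp (- \<phi> x))))"
proof -
  let ?n = "real CARD('n)" and ?M = "lebesgue_on \<Omega>"
  have \<Omega>: "\<Omega> = - cball 0 1" using assms(2) by simp
  have open_\<Omega>: "open \<Omega>" by (simp add: \<Omega> open_Compl)
  have \<Omega>_norm: "1 < norm x" if "x \<in> \<Omega>" for x using that by (simp add: \<Omega>)
  then have \<Omega>_nz: "x \<noteq> 0" if "x \<in> \<Omega>" for x using that by force
  have space_M: "space ?M = \<Omega>" by simp
  have n: "3 \<le> ?n" using assms(1) by simp
  have u: "u m x = clif_of_real (norm x powr (- 1 / real m))" for m x by (simp add: assms(4))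
  have f: "f m x = (- (1 / real m) * norm x powr (- 1 / real m - 2)) *\<^sub>R clif_vec x" for m x
    by (simp add: assms(5))
  have \<phi>_borel: "\<phi> \<in> borel_measurable borel" unfolding assms(3) by measurable
  note \<phi>_meas = borel_measurable_lebesgue_on [OF \<phi>_borel, of \<Omega>]
  have classical: "u m differentiable (at x) \<and> dirac (u m) x = f m x" if "x \<in> \<Omega>" for m x
    using partial_deriv_norm_powr(1) [OF \<Omega>_nz [OF that]] dirac_norm_powr [OF \<Omega>_nz [OF that]]
    by (simp add: assms(4) f)
  have weak: "weak_dirac_solution \<Omega> (f m) (u m)" for m
  proof (rule classical_imp_weak_dirac_solution [OF open_\<Omega>])
    fix j
    have "continuous_on \<Omega> (\<lambda>x. clif_of_real (- 1 / real m * norm x powr (- 1 / real m - 2) * x $ j)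
        :: 'n clifford)"
      using \<Omega>_nz
      by (intro bounded_linear.continuous_on [OF bounded_linear_clif_of_real] continuous_intros) auto
    then show "continuous_on \<Omega> (partial_deriv j (u m))"
      by (rule continuous_on_eq) (simp add: assms(4) partial_deriv_norm_powr(2) \<Omega>_nz)
  qed (use classical in auto)
  have u_L2: "u m \<in> L2_weighted \<phi> \<Omega>" if "1 \<le> m" for m
    using norm_powr_L2_weighted [of "real m"] that by (simp add: \<Omega> assms(3,4))
  have orth: "(LINT x|?M. (w x \<bullet> u m x) * exp (- \<phi> x)) = (LINT x|?M. (u m x \<bullet> u m x) * exp (- \<phi> x))"
    if "1 \<le> m" "w \<in> L2_weighted \<phi> \<Omega>" "weak_dirac_solution \<Omega> (f m) w" for m w
  proof -
    let ?v = "\<lambda>k. test_field (real m) (real (Suc k)) :: real ^ 'n::{finite,linorder} \<Rightarrow> 'n clifford"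
    have lim: "(\<lambda>k. LINT x|?M. h x \<bullet> dirac (?v k) x) \<longlonglongrightarrow> - (LINT x|?M. (h x \<bullet> u m x) * exp (- \<phi> x))"
      if "h \<in> L2_weighted \<phi> \<Omega>" for h
      using test_field_integral_tendsto [of h "real m"] that \<open>1 \<le> m\<close>
      by (simp add: \<Omega> assms(3) u)
    have v: "?v k \<in> test_functions \<Omega>" for k
      unfolding \<Omega> by (rule test_field_test_function) simp
    have "(LINT x|?M. w x \<bullet> dirac (?v k) x) = (LINT x|?M. u m x \<bullet> dirac (?v k) x)" for k
      by (rule trans [OF sym [OF bspec [OF that(3) [unfolded weak_dirac_solution_def] v]]
          bspec [OF weak [unfolded weak_dirac_solution_def] v]])
    then have "(\<lambda>k. LINT x|?M. w x \<bullet> dirac (?v k) x) = (\<lambda>k. LINT x|?M. u m x \<bullet> dirac (?v k) x)"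
      by (rule ext)
    from LIMSEQ_unique [OF lim [OF that(2), unfolded this] lim [OF u_L2 [OF that(1)]]]
    show ?thesis by (simp only: neg_equal_iff_equal)
  qed
  have minimal: "minimal_dirac_solution \<phi> \<Omega> (f m) (u m)" if "1 \<le> m" for m
    unfolding minimal_dirac_solution_def
    using u_L2 [OF that] weak [of m] norm_weighted_minimal_if_orthogonal [OF \<phi>_meas u_L2 [OF that] _ orth [OF that]]
    by blast
  define I where "I = (\<lambda>m. (norm_weighted \<phi> \<Omega> (u m))\<^sup>2)"
  have I_eq: "I m = (LINT x|?M. (norm (u m x))\<^sup>2 * exp (- \<phi> x))" for m
    unfolding I_def by (rule norm_weighted_square)
  have I_pos: "0 < I m" if "1 \<le> m" for m
  proof -
    have int: "integrable ?M (\<lambda>x. (norm (u m x))\<^sup>2 * exp (- \<phi> x))"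
      using u_L2 [OF that] by (simp add: L2_weighted_def)
    have "\<not> (AE x in ?M. (norm (u m x))\<^sup>2 * exp (- \<phi> x) = 0)"
    proof
      assume "AE x in ?M. (norm (u m x))\<^sup>2 * exp (- \<phi> x) = 0"
      then have "AE x in ?M. False"
        by (rule AE_mp) (use \<Omega>_nz [of 0] in \<open>auto intro!: AE_I2 simp: u norm_clif_of_real\<close>)
      then have "AE x in lebesgue. x \<notin> \<Omega>"
        using open_\<Omega> by (subst (asm) AE_restrict_space_iff) auto
      then have "\<Omega> \<in> null_sets lebesgue"
        using open_\<Omega> by (intro iffD2 [OF AE_iff_null_sets]) auto
      then have "negligible \<Omega>" by (simp add: negligible_iff_null_sets)
      moreover have "2 *\<^sub>R axis undefined 1 \<in> \<Omega>" by (simp add: \<Omega>)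
      ultimately show False using open_not_negligible [OF open_\<Omega>] by blast
    qed
    then have "I m \<noteq> 0"
      unfolding I_eq using integral_nonneg_eq_0_iff_AE [OF int] by simp
    moreover have "0 \<le> I m" by (simp add: I_def)
    ultimately show ?thesis by simp
  qed
  have f_weighted: "(norm (f m x))\<^sup>2 / laplacian \<phi> x * exp (- \<phi> x)
      = 1 / ((real m)\<^sup>2 * (?n * (?n - 2))) * ((norm (u m x))\<^sup>2 * exp (- \<phi> x))" if "x \<in> \<Omega>" for m x
  proof -
    \<comment> \<open>\<open>|f\<^sub>m| |x| = |u\<^sub>m| / m\<close>, and the square of \<open>|x|\<close> is what \<open>\<Delta>\<phi>\<close> contributes.\<close>
    have "norm (f m x) * norm x = (norm x * (norm x * norm x powr (- 1 / real m - 2))) / real m"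
      by (simp add: f norm_clif_vec mult_ac)
    also have "\<dots> = norm (u m x) / real m"
      unfolding norm_powr_step [OF \<Omega>_nz [OF that]] by (simp add: u norm_clif_of_real)
    finally have "norm (f m x) * norm x = norm (u m x) / real m" .
    then have "(norm (f m x))\<^sup>2 * (norm x)\<^sup>2 = (norm (u m x))\<^sup>2 / (real m)\<^sup>2"
      by (metis power_mult_distrib power_divide)
    moreover have "laplacian \<phi> x = ?n * (?n - 2) / (norm x)\<^sup>2"
      unfolding assms(3) by (rule laplacian_ln_norm [OF \<Omega>_nz [OF that]])
    ultimately show ?thesis by simp
  qed
  have J_eq: "(LINT x|?M. (norm (f m x))\<^sup>2 / laplacian \<phi> x * exp (- \<phi> x))
      = I m / ((real m)\<^sup>2 * (?n * (?n - 2)))" for m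
  proof -
    have "(LINT x|?M. (norm (f m x))\<^sup>2 / laplacian \<phi> x * exp (- \<phi> x))
        = (LINT x|?M. 1 / ((real m)\<^sup>2 * (?n * (?n - 2))) * ((norm (u m x))\<^sup>2 * exp (- \<phi> x)))"
      by (rule Bochner_Integration.integral_cong [OF refl]) (simp only: space_M f_weighted)
    also have "\<dots> = 1 / ((real m)\<^sup>2 * (?n * (?n - 2))) * I m"
      unfolding I_eq by (rule integral_mult_right_zero)
    finally show ?thesis by simp
  qed
  have lim_square: "filterlim (\<lambda>m. (real m)\<^sup>2 * (?n * (?n - 2))) at_top sequentially"
  proof -
    define c where "c = ?n * (?n - 2)"
    have "0 < c" using n by (simp add: c_def)
    then show ?thesis unfolding c_def [symmetric] by real_asymp
  qed
  have ratio: "filterlim (\<lambda>m. I m /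
      (LINT x|?M. (norm (f m x))\<^sup>2 / laplacian \<phi> x * exp (- \<phi> x))) at_top sequentially"
  proof (rule filterlim_mono_eventually [OF lim_square order_refl order_refl])
    show "eventually (\<lambda>m. (real m)\<^sup>2 * (?n * (?n - 2)) = I m /
        (LINT x|?M. (norm (f m x))\<^sup>2 / laplacian \<phi> x * exp (- \<phi> x))) sequentially"
      using eventually_ge_at_top [of 1]
    proof eventually_elim
      case (elim m)
      then show ?case unfolding J_eq using I_pos [of m] by simp
    qed
  qed
  have no_estimate: "\<not> (\<forall>g \<in> L2_weighted \<phi> \<Omega>.
      integrable ?M (\<lambda>x. (norm (g x))\<^sup>2 / laplacian \<phi> x * exp (- \<phi> x)) \<longrightarrow>
      (\<exists>w \<in> L2_weighted \<phi> \<Omega>. weak_dirac_solution \<Omega> g w \<and>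
        (norm_weighted \<phi> \<Omega> w)\<^sup>2 \<le>
          C * (LINT x|?M. (norm (g x))\<^sup>2 / laplacian \<phi> x * exp (- \<phi> x))))" for C
  proof
    assume est: "\<forall>g \<in> L2_weighted \<phi> \<Omega>.
      integrable ?M (\<lambda>x. (norm (g x))\<^sup>2 / laplacian \<phi> x * exp (- \<phi> x)) \<longrightarrow>
      (\<exists>w \<in> L2_weighted \<phi> \<Omega>. weak_dirac_solution \<Omega> g w \<and>
        (norm_weighted \<phi> \<Omega> w)\<^sup>2 \<le>
          C * (LINT x|?M. (norm (g x))\<^sup>2 / laplacian \<phi> x * exp (- \<phi> x)))"
    have "eventually (\<lambda>m. 1 \<le> m \<and> C < (real m)\<^sup>2 * (?n * (?n - 2))) sequentially"
      using lim_square eventually_ge_at_top [of "1 :: nat"]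
      by (auto simp: filterlim_at_top_dense intro: eventually_conj)
    then obtain m where m: "1 \<le> m" "C < (real m)\<^sup>2 * (?n * (?n - 2))"
      using eventually_happens by force
    have int_u: "integrable ?M (\<lambda>x. (norm (u m x))\<^sup>2 * exp (- \<phi> x))"
      using u_L2 [OF m(1)] by (simp add: L2_weighted_def)
    have "(clif_vec :: real ^ 'n::{finite,linorder} \<Rightarrow> 'n clifford) \<in> borel_measurable borel"
      by (intro borel_measurable_continuous_onI linear_continuous_on bounded_linear_clif_vec)
    then have f_borel: "f m \<in> borel_measurable borel" unfolding assms(5) by measurable
    then have "(\<lambda>x. (norm (f m x))\<^sup>2 * exp (- \<phi> x)) \<in> borel_measurable borel"
      using \<phi>_borel by measurable
    note f_meas = this [THEN borel_measurable_lebesgue_on] f_borel [THEN borel_measurable_lebesgue_on]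
    have "integrable ?M (\<lambda>x. (norm (f m x))\<^sup>2 * exp (- \<phi> x))"
    proof (rule Bochner_Integration.integrable_bound [OF int_u f_meas(1)], intro AE_I2)
      fix x assume "x \<in> space ?M"
      then have x: "1 < norm x" using \<Omega>_norm by simp
      have "norm (f m x) = 1 / real m * norm x powr (- 1 / real m - 1)"
        using x by (subst norm_powr_step(1) [symmetric]) (auto simp: f norm_clif_vec mult_ac)
      also have "\<dots> \<le> 1 * norm x powr (- 1 / real m)"
        using x m(1) by (intro mult_mono powr_mono) auto
      also have "\<dots> = norm (u m x)" by (simp add: u norm_clif_of_real)
      finally have "(norm (f m x))\<^sup>2 \<le> (norm (u m x))\<^sup>2" by (rule power_mono) simp
      then show "norm ((norm (f m x))\<^sup>2 * exp (- \<phi> x)) \<le> norm ((norm (u m x))\<^sup>2 * exp (- \<phi> x))"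
        by (simp add: abs_mult)
    qed
    then have f_L2: "f m \<in> L2_weighted \<phi> \<Omega>" using f_meas(2) by (simp add: L2_weighted_def)
    have "integrable ?M (\<lambda>x. (norm (f m x))\<^sup>2 / laplacian \<phi> x * exp (- \<phi> x)) \<longleftrightarrow>
        integrable ?M (\<lambda>x. 1 / ((real m)\<^sup>2 * (?n * (?n - 2))) * ((norm (u m x))\<^sup>2 * exp (- \<phi> x)))"
      by (rule Bochner_Integration.integrable_cong [OF refl]) (simp only: space_M f_weighted)
    then have "integrable ?M (\<lambda>x. (norm (f m x))\<^sup>2 / laplacian \<phi> x * exp (- \<phi> x))"
      using int_u by simp
    then obtain w where w: "w \<in> L2_weighted \<phi> \<Omega>" "weak_dirac_solution \<Omega> (f m) w"
      "(norm_weighted \<phi> \<Omega> w)\<^sup>2 \<le> C * (I m / ((real m)\<^sup>2 * (?n * (?n - 2))))"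
      using est f_L2 unfolding J_eq [symmetric] by blast
    have "norm_weighted \<phi> \<Omega> (u m) \<le> norm_weighted \<phi> \<Omega> w"
      using minimal [OF m(1)] w(1,2) by (simp add: minimal_dirac_solution_def)
    then have "I m \<le> (norm_weighted \<phi> \<Omega> w)\<^sup>2"
      unfolding I_def by (rule power_mono) (simp add: norm_weighted_def)
    with w(3) have "I m \<le> C * (I m / ((real m)\<^sup>2 * (?n * (?n - 2))))" by linarith
    moreover have "0 < (real m)\<^sup>2 * (?n * (?n - 2))" using m(1) n by simp
    ultimately have "I m * ((real m)\<^sup>2 * (?n * (?n - 2))) \<le> I m * C"
      by (simp add: field_simps)
    then show False using I_pos [OF m(1)] m(2) by (simp only: mult_le_cancel_left_pos)
  qed
  show ?thesis
    using classical weak minimal ratio [unfolded I_def] no_estimate by blast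
qed

end
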